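(* Let $p\in\{0,1,\ldots,6\}$. (i) For a p-symmetric domain $\Omega=\Omega_D$ with $\Omega\cap\mathbb{R}^{p+1}=\emptyset$, it holds that $\mathcal{GSM}(\Omega)\supsetneqq\mathcal{GSR}(\Omega_D)$. (ii) For a p-symmetric domain $\Omega=\Omega_D$ with $\Omega\cap\mathbb{R}^{p+1}\ne\emptyset$, it holds that $\mathcal{GSM}(\Omega)=\mathcal{GSR}(\Omega_D)$.
   Context: $\mathbb{O}$ is the real, non-associative, alternative algebra of octonions with basis $e_0=1,e_1,\ldots,e_7$ and product $e_ie_j=-\delta_{ij}+\sum_k\epsilon_{ijk}e_k$ for $1\le i,j\le 7$, where $\epsilon_{ijk}$ is totally antisymmetric, equals $1$ on the triples $(1,2,3),(1,4,5),(2,4,6),(3,4,7),(5,3,6),(6,1,7),(7,2,5)$, and vanishes on triples that are not permutations of these. $\mathbb{O}$ is identified with $\mathbb{R}^8$. A domain is a nonempty connected open set. Fix $p\in\{0,\ldots,6\}$. $\mathbb{R}^{p+1}$ denotes the real span of $e_0,\ldots,e_p$, with elements $\boldsymbol{x}_p=\sum_{i=0}^px_ie_i$, and $\mathbb{S}=\{\sum_{i=p+1}^7x_ie_i:\sum_{i=p+1}^7x_i^2=1\}$. For $\Omega\subseteq\mathbb{O}$ open and $\underline{\omega}\in\mathbb{S}$, $\Omega_{\underline{\omega}}=\Omega\cap(\mathbb{R}^{p+1}\oplus\underline{\omega}\mathbb{R})$ is viewed as an open subset of $\mathbb{R}^{p+2}$ with coordinates $(x_0,\ldots,x_p,r)\leftrightarrow\boldsymbol{x}_p+r\underline{\omega}$.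 $\Omega$ is p-symmetric if $\boldsymbol{x}_p+r\underline{\omega}\in\Omega$ with $\boldsymbol{x}_p\in\mathbb{R}^{p+1}$, $r>0$, $\underline{\omega}\in\mathbb{S}$ implies $\boldsymbol{x}_p+r\mathbb{S}\subseteq\Omega$. $\mathcal{GSM}(\Omega)$ is the set of (left) generalized partial-slice monogenic functions of type $p$ on the domain $\Omega$, i.e. functions $f:\Omega\to\mathbb{O}$ such that, for every $\underline{\omega}\in\mathbb{S}$, the restriction $f_{\underline{\omega}}$ to $\Omega_{\underline{\omega}}$ is of class $C^1$ and satisfies $\sum_{i=0}^pe_i\,\partial_{x_i}f_{\underline{\omega}}+\underline{\omega}\,\partial_rf_{\underline{\omega}}=0$ on $\Omega_{\underline{\omega}}$. An open set $D\subseteq\mathbb{R}^{p+2}$ is invariant under the reflection of the $(p+2)$-th variable if $(\boldsymbol{x}_p,r)\in D$ implies $(\boldsymbol{x}_p,-r)\in D$. Its p-symmetric completion is $\Omega_D=\{\boldsymbol{x}_p+r\underline{\omega}:\underline{\omega}\in\mathbb{S},\ r\ge0,\ (\boldsymbol{x}_p,r)\in D\}\subseteq\mathbb{O}$. In the claim, $D$ is such a reflection-invariant open set. A stem function on $D$ is $F=(F_1,F_2):D\to\mathbb{O}^2$ with $F_1(\boldsymbol{x}_p,-r)=F_1(\boldsymbol{x}_p,r)$ and $F_2(\boldsymbol{x}_p,-r)=-F_2(\boldsymbol{x}_p,r)$; it induces $\mathcal{I}(F):\Omega_D\to\mathbb{O}$, $\mathcal{I}(F)(\boldsymbol{x}_p+r\underline{\omega})=F_1(\boldsymbol{x}_p,r)+\underline{\omega}F_2(\boldsymbol{x}_p,r)$.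 $\mathcal{GSR}(\Omega_D)$ is the set of generalized partial-slice regular functions of type $p$: the functions $f=\mathcal{I}(F)$ with $F=(F_1,F_2)$ a $C^1$ stem function on $D$ satisfying $D_{\boldsymbol{x}_p}F_1-\partial_rF_2=0$ and $\overline{D}_{\boldsymbol{x}_p}F_2+\partial_rF_1=0$ on $D$, where $D_{\boldsymbol{x}_p}=\sum_{i=0}^pe_i\partial_{x_i}$ and $\overline{D}_{\boldsymbol{x}_p}=\partial_{x_0}-\sum_{i=1}^pe_i\partial_{x_i}$ act by left multiplication. *)

theory Defs
  imports "HOL-Analysis.Analysis"
begin

section \<open>Octonions\<close>

text \<open>
  The octonions are the vector space \<open>real^8\<close> with their own product; the componentwise
  product \<open>*\<close> that the library puts on \<open>real^8\<close> is not used. The numerals of the index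
  type \<open>8\<close> denote residues modulo 8, so \<open>of_nat i\<close> for \<open>i \<le> 7\<close> enumerates the coordinates.
\<close>

type_synonym oct = "real^8"

definition oct_e :: "nat \<Rightarrow> oct"
  where "oct_e i = axis (of_nat i) 1"

definition oct_triples :: "(nat \<times> nat \<times> nat) set"
  where "oct_triples = {(1,2,3), (1,4,5), (2,4,6), (3,4,7), (5,3,6), (6,1,7), (7,2,5)}"

definition oct_eps :: "nat \<Rightarrow> nat \<Rightarrow> nat \<Rightarrow> real"
  where "oct_eps i j k =
    (if (i,j,k) \<in> oct_triples \<or> (j,k,i) \<in> oct_triples \<or> (k,i,j) \<in> oct_triples then 1
     else if (j,i,k) \<in> oct_triples \<or> (i,k,j) \<in> oct_triples \<or> (k,j,i) \<in> oct_triples then - 1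
     else 0)"

definition oct_e_prod :: "nat \<Rightarrow> nat \<Rightarrow> oct"
  where "oct_e_prod i j =
    (if i = 0 then oct_e j
     else if j = 0 then oct_e i
     else (if i = j then - oct_e 0 else 0) + (\<Sum>k=1..7. oct_eps i j k *\<^sub>R oct_e k))"

definition oct_mult :: "oct \<Rightarrow> oct \<Rightarrow> oct"  (infixl "\<odot>" 70)
  where "x \<odot> y =
    (\<Sum>i\<le>7. \<Sum>j\<le>7. (x $ of_nat i * y $ of_nat j) *\<^sub>R oct_e_prod i j)"


section \<open>Slices and partial derivatives\<close>

definition paravecs :: "nat \<Rightarrow> oct set"
  where "paravecs p = span (oct_e ` {..p})"

definition unit_sphere :: "nat \<Rightarrow> oct set"
  where "unit_sphere p =
    {\<Sum>i=p+1..7. x i *\<^sub>R oct_e i | x :: nat \<Rightarrow> real. (\<Sum>i=p+1..7. (x i)\<^sup>2) = 1}"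

text \<open>
  Since \<open>p\<close> is a variable, the Euclidean space of dimension \<open>p + 2\<close> is not a type of its own but
  the subspace \<open>param_space p\<close> of \<open>oct \<times> real\<close>, whose points are the pairs of an element
  of the span of \<open>oct_e 0, \<dots>, oct_e p\<close> and a real number \<open>r\<close>. Its open subsets are the relatively
  open ones, and only the \<open>p + 2\<close> coordinate directions are differentiated.
\<close>

definition param_space :: "nat \<Rightarrow> (oct \<times> real) set"
  where "param_space p = paravecs p \<times> UNIV"

definition partial_x :: "nat \<Rightarrow> (oct \<times> real \<Rightarrow> oct) \<Rightarrow> oct \<times> real \<Rightarrow> oct"
  where "partial_x i F z =
    vector_derivative (\<lambda>t. F (fst z + t *\<^sub>R oct_e i, snd z)) (at 0)"

definition partial_r :: "(oct \<times> real \<Rightarrow> oct) \<Rightarrow> oct \<times> real \<Rightarrow> oct"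
  where "partial_r F z = vector_derivative (\<lambda>t. F (fst z, t)) (at (snd z))"

text \<open>
  The following is meant for relatively open subsets \<open>U\<close> of \<open>param_space p\<close>; the values of \<open>F\<close>
  outside \<open>U\<close> are then irrelevant.
\<close>

definition C1_on :: "nat \<Rightarrow> (oct \<times> real) set \<Rightarrow> (oct \<times> real \<Rightarrow> oct) \<Rightarrow> bool"
  where "C1_on p U F \<longleftrightarrow>
    (\<forall>i\<le>p. (\<forall>z\<in>U. (\<lambda>t. F (fst z + t *\<^sub>R oct_e i, snd z)) differentiable (at 0))
         \<and> continuous_on U (partial_x i F))
    \<and> (\<forall>z\<in>U. (\<lambda>t. F (fst z, t)) differentiable (at (snd z)))
    \<and> continuous_on U (partial_r F)"

definition dirac_x :: "nat \<Rightarrow> (oct \<times> real \<Rightarrow> oct) \<Rightarrow> oct \<times> real \<Rightarrow> oct"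
  where "dirac_x p F z = (\<Sum>i=0..p. oct_e i \<odot> partial_x i F z)"

definition dirac_x_conj :: "nat \<Rightarrow> (oct \<times> real \<Rightarrow> oct) \<Rightarrow> oct \<times> real \<Rightarrow> oct"
  where "dirac_x_conj p F z = partial_x 0 F z - (\<Sum>i=1..p. oct_e i \<odot> partial_x i F z)"


section \<open>Generalized partial-slice monogenic functions\<close>

definition is_domain :: "oct set \<Rightarrow> bool"
  where "is_domain \<Omega> \<longleftrightarrow> open \<Omega> \<and> connected \<Omega> \<and> \<Omega> \<noteq> {}"

definition p_symmetric :: "nat \<Rightarrow> oct set \<Rightarrow> bool"
  where "p_symmetric p \<Omega> \<longleftrightarrow>
    (\<forall>x\<in>paravecs p. \<forall>r>0. \<forall>\<omega>\<in>unit_sphere p.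
       x + r *\<^sub>R \<omega> \<in> \<Omega> \<longrightarrow> (\<forall>\<eta>\<in>unit_sphere p. x + r *\<^sub>R \<eta> \<in> \<Omega>))"

definition slice_dom :: "nat \<Rightarrow> oct set \<Rightarrow> oct \<Rightarrow> (oct \<times> real) set"
  where "slice_dom p \<Omega> \<omega> = {(x, r) \<in> param_space p. x + r *\<^sub>R \<omega> \<in> \<Omega>}"

definition slice_fun :: "(oct \<Rightarrow> oct) \<Rightarrow> oct \<Rightarrow> oct \<times> real \<Rightarrow> oct"
  where "slice_fun f \<omega> = (\<lambda>(x, r). f (x + r *\<^sub>R \<omega>))"

text \<open>
  Functions defined on \<open>\<Omega>\<close> are represented by total functions that are \<open>undefined\<close> outside \<open>\<Omega>\<close>,
  so that equality and inclusion of function spaces refer to the values on \<open>\<Omega>\<close> only.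
\<close>

definition GSM :: "nat \<Rightarrow> oct set \<Rightarrow> (oct \<Rightarrow> oct) set"
  where "GSM p \<Omega> = {f \<in> extensional \<Omega>. \<forall>\<omega>\<in>unit_sphere p.
    C1_on p (slice_dom p \<Omega> \<omega>) (slice_fun f \<omega>) \<and>
    (\<forall>z\<in>slice_dom p \<Omega> \<omega>.
       dirac_x p (slice_fun f \<omega>) z + \<omega> \<odot> partial_r (slice_fun f \<omega>) z = 0)}"


section \<open>Generalized partial-slice regular functions\<close>

definition reflection_invariant_open :: "nat \<Rightarrow> (oct \<times> real) set \<Rightarrow> bool"
  where "reflection_invariant_open p D \<longleftrightarrow>
    openin (top_of_set (param_space p)) D \<and> (\<forall>x r. (x, r) \<in> D \<longrightarrow> (x, - r) \<in> D)"

definition p_completion :: "nat \<Rightarrow> (oct \<times> real) set \<Rightarrow> oct set"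
  where "p_completion p D =
    {x + r *\<^sub>R \<omega> | x r \<omega>. \<omega> \<in> unit_sphere p \<and> r \<ge> 0 \<and> (x, r) \<in> D}"

definition stem :: "(oct \<times> real) set \<Rightarrow> (oct \<times> real \<Rightarrow> oct) \<Rightarrow> (oct \<times> real \<Rightarrow> oct) \<Rightarrow> bool"
  where "stem D F1 F2 \<longleftrightarrow>
    (\<forall>x r. (x, r) \<in> D \<longrightarrow> F1 (x, - r) = F1 (x, r) \<and> F2 (x, - r) = - F2 (x, r))"

text \<open>For a stem function, \<open>induced_apply\<close> below shows that this description is unambiguous.\<close>

definition induced ::
    "nat \<Rightarrow> (oct \<times> real) set \<Rightarrow> (oct \<times> real \<Rightarrow> oct) \<Rightarrow> (oct \<times> real \<Rightarrow> oct) \<Rightarrow> oct \<Rightarrow> oct"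
  where "induced p D F1 F2 = (\<lambda>z\<in>p_completion p D.
    THE w. \<exists>x r \<omega>. \<omega> \<in> unit_sphere p \<and> r \<ge> 0 \<and> (x, r) \<in> D \<and> z = x + r *\<^sub>R \<omega>
             \<and> w = F1 (x, r) + \<omega> \<odot> F2 (x, r))"

definition GSR :: "nat \<Rightarrow> (oct \<times> real) set \<Rightarrow> (oct \<Rightarrow> oct) set"
  where "GSR p D = {induced p D F1 F2 | F1 F2.
    stem D F1 F2 \<and> C1_on p D F1 \<and> C1_on p D F2 \<and>
    (\<forall>z\<in>D. dirac_x p F1 z - partial_r F2 z = 0 \<and> dirac_x_conj p F2 z + partial_r F1 z = 0)}"


section \<open>The induced function is well defined\<close>

lemma of_nat_8_inj:
  assumes "i \<le> 7" "j \<le> 7" "(of_nat i :: 8) = of_nat j"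
  shows "i = j"
proof -
  have "i \<in> {0,1,2,3,4,5,6,7}" "j \<in> {0,1,2,3,4,5,6,7}" using assms by auto
  with assms(3) show ?thesis by auto
qed

lemma inner_oct_e:
  assumes "i \<le> 7" "j \<le> 7"
  shows "oct_e i \<bullet> oct_e j = (if i = j then 1 else 0)"
  using of_nat_8_inj[OF assms] by (auto simp: oct_e_def inner_axis_axis)

lemma inner_paravecs_unit_sphere:
  assumes x: "x \<in> paravecs p" and \<omega>: "\<omega> \<in> unit_sphere p" and p: "p \<le> 7"
  shows "x \<bullet> \<omega> = 0"
proof -
  obtain c :: "nat \<Rightarrow> real" where c: "\<omega> = (\<Sum>i=p+1..7. c i *\<^sub>R oct_e i)"
    using \<omega> by (auto simp: unit_sphere_def)
  have "oct_e j \<bullet> \<omega> = 0" if "j \<le> p" for j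
    unfolding c inner_sum_right using that p by (intro sum.neutral) (auto simp: inner_oct_e)
  then have "oct_e ` {..p} \<subseteq> {y. y \<bullet> \<omega> = 0}" by auto
  moreover have "subspace {y. y \<bullet> \<omega> = 0}"
    by (auto simp: subspace_def inner_add_left)
  ultimately have "paravecs p \<subseteq> {y. y \<bullet> \<omega> = 0}"
    unfolding paravecs_def by (rule span_minimal)
  with x show ?thesis by auto
qed

lemma norm_unit_sphere:
  assumes "\<omega> \<in> unit_sphere p"
  shows "norm \<omega> = 1"
proof -
  obtain c :: "nat \<Rightarrow> real" where c: "\<omega> = (\<Sum>i=p+1..7. c i *\<^sub>R oct_e i)"
      "(\<Sum>i=p+1..7. (c i)\<^sup>2) = 1"
    using assms by (auto simp: unit_sphere_def)
  have "\<omega> \<bullet> \<omega> = (\<Sum>i=p+1..7. \<Sum>j=p+1..7. c i * c j * (oct_e i \<bullet> oct_e j))"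
    unfolding c(1) by (simp add: inner_sum_left inner_sum_right sum_distrib_left inner_commute ac_simps)
  also have "\<dots> = (\<Sum>i=p+1..7. \<Sum>j=p+1..7. if i = j then (c i)\<^sup>2 else 0)"
    by (intro sum.cong refl) (auto simp: inner_oct_e power2_eq_square)
  also have "\<dots> = (\<Sum>i=p+1..7. (c i)\<^sup>2)"
    by (intro sum.cong refl) (auto simp: sum.delta)
  finally show ?thesis using c(2) by (simp add: norm_eq_1)
qed

lemma p_completion_decomp_unique:
  assumes "x \<in> paravecs p" "y \<in> paravecs p" "\<omega> \<in> unit_sphere p" "\<eta> \<in> unit_sphere p"
    and "r \<ge> 0" "s \<ge> 0" "x + r *\<^sub>R \<omega> = y + s *\<^sub>R \<eta>" "p \<le> 7"
  shows "x = y" "r = s" "r \<noteq> 0 \<Longrightarrow> \<omega> = \<eta>"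
proof -
  have d: "x - y \<in> paravecs p" using assms by (simp add: paravecs_def span_diff)
  have e: "x - y = s *\<^sub>R \<eta> - r *\<^sub>R \<omega>" using assms(7) by (simp add: algebra_simps)
  have "(x - y) \<bullet> (x - y) = (x - y) \<bullet> (s *\<^sub>R \<eta> - r *\<^sub>R \<omega>)" using e by simp
  also have "\<dots> = 0"
    using inner_paravecs_unit_sphere[OF d] assms by (simp add: inner_diff_right)
  finally show xy: "x = y" by simp
  then have sr: "r *\<^sub>R \<omega> = s *\<^sub>R \<eta>" using assms(7) by simp
  then have "norm (r *\<^sub>R \<omega>) = norm (s *\<^sub>R \<eta>)" by simp
  then show "r = s" using assms norm_unit_sphere by simp
  then show "r \<noteq> 0 \<Longrightarrow> \<omega> = \<eta>" using sr by simp
qed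

lemma oct_mult_zero_right: "x \<odot> 0 = 0"
  by (simp add: oct_mult_def)

lemma induced_apply:
  assumes "p \<le> 6" "reflection_invariant_open p D" "stem D F1 F2"
    and \<omega>: "\<omega> \<in> unit_sphere p" "r \<ge> 0" "(x, r) \<in> D"
  shows "induced p D F1 F2 (x + r *\<^sub>R \<omega>) = F1 (x, r) + \<omega> \<odot> F2 (x, r)"
proof -
  have sub: "y \<in> paravecs p" if "(y, s) \<in> D" for y s
    using that assms(2) openin_subset[of "top_of_set (param_space p)" D]
    by (auto simp: reflection_invariant_open_def param_space_def)
  have odd: "F2 (y, 0) = 0" if "(y, 0) \<in> D" for y
  proof -
    have "F2 (y, - 0) = - F2 (y, 0)" using that assms(3) unfolding stem_def by blast
    then have "F2 (y, 0) $ k = - (F2 (y, 0) $ k)" for k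
      by (metis minus_zero vector_uminus_component)
    then have "F2 (y, 0) $ k = 0" for k by simp
    then show ?thesis by (simp add: vec_eq_iff)
  qed
  have "x + r *\<^sub>R \<omega> \<in> p_completion p D" using \<omega> by (auto simp: p_completion_def)
  moreover have "(THE w. \<exists>y s \<eta>. \<eta> \<in> unit_sphere p \<and> s \<ge> 0 \<and> (y, s) \<in> D
      \<and> x + r *\<^sub>R \<omega> = y + s *\<^sub>R \<eta> \<and> w = F1 (y, s) + \<eta> \<odot> F2 (y, s))
      = F1 (x, r) + \<omega> \<odot> F2 (x, r)"
  proof (rule the_equality)
    show "\<exists>y s \<eta>. \<eta> \<in> unit_sphere p \<and> s \<ge> 0 \<and> (y, s) \<in> D \<and> x + r *\<^sub>R \<omega> = y + s *\<^sub>R \<eta>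
        \<and> F1 (x, r) + \<omega> \<odot> F2 (x, r) = F1 (y, s) + \<eta> \<odot> F2 (y, s)"
      using \<omega> by blast
  next
    fix w
    assume "\<exists>y s \<eta>. \<eta> \<in> unit_sphere p \<and> s \<ge> 0 \<and> (y, s) \<in> D
      \<and> x + r *\<^sub>R \<omega> = y + s *\<^sub>R \<eta> \<and> w = F1 (y, s) + \<eta> \<odot> F2 (y, s)"
    then obtain y s \<eta> where h: "\<eta> \<in> unit_sphere p" "s \<ge> 0" "(y, s) \<in> D"
      "x + r *\<^sub>R \<omega> = y + s *\<^sub>R \<eta>" "w = F1 (y, s) + \<eta> \<odot> F2 (y, s)" by blast
    have u: "x = y" "r = s" "r \<noteq> 0 \<Longrightarrow> \<omega> = \<eta>"
      using p_completion_decomp_unique[of x p y \<omega> \<eta> r s] sub[OF \<omega>(3)] sub[OF h(3)] \<omega> h assms(1)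
      by auto
    show "w = F1 (x, r) + \<omega> \<odot> F2 (x, r)"
    proof (cases "r = 0")
      case True
      then show ?thesis using u odd[of x] h \<omega>(3) by (simp add: oct_mult_zero_right)
    next
      case False
      then show ?thesis using u h by simp
    qed
  qed
  ultimately show ?thesis by (simp add: induced_def)
qed

end

theory Submission
  imports Defs "HOL-Complex_Analysis.Conformal_Mappings"
begin

text \<open>
  Slice regular functions are slice monogenic by a computation. On the slice through \<open>\<omega>\<close> the
  function induced by \<open>(F1, F2)\<close> is \<open>F1 + \<omega> \<odot> F2\<close>. Left multiplication by \<open>\<omega>\<close> anticommutes with
  left multiplication by \<open>oct_e 1, \<dots>, oct_e p\<close>, commutes with that by \<open>oct_e 0\<close> and squares to
  \<open>-1\<close>, so that the two equations for the stem function add up to the slice equation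
  (\<open>GSR_subset_GSM\<close>). Apart from bilinearity and the unit \<open>oct_e 0\<close>, all that is used
  about the octonion product is the identity \<open>oct_conj w \<odot> (w \<odot> a) = (w \<bullet> w) *\<^sub>R a\<close>, which takes
  the place of associativity.

  If \<open>\<Omega>\<close> avoids \<open>paravecs p\<close>, the half slices \<open>r > 0\<close> in different directions are independent of
  one another. The function that is \<open>oct_e 0\<close> on one half slice and zero on the others is locally
  constant on every slice, hence monogenic, but not of the form \<open>F1 + \<omega> \<odot> F2\<close>: two opposite
  directions in which it vanishes force \<open>F1 = 0\<close> and \<open>F2 = 0\<close> (\<open>GSM_not_subset_GSR\<close>). Such
  directions exist for \<open>p \<le> 5\<close>; for \<open>p = 6\<close> the set \<open>paravecs p\<close> is a hyperplane, and a
  connected \<open>\<Omega>\<close> cannot avoid it, since by symmetry it has points on both sides.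

  If \<open>\<Omega>\<close> meets \<open>paravecs p\<close>, let \<open>f\<close> be monogenic and fix one direction \<open>\<eta>\<close>. The even and the odd
  part in \<open>r\<close> of the restriction of \<open>f\<close> to the slice through \<open>\<eta>\<close> form a stem function, and the
  regular function \<open>k\<close> that it induces agrees with \<open>f\<close> on this slice (\<open>GSM_slice_in_GSR\<close>). On any
  other slice \<open>f - k\<close> solves the slice equation and vanishes for \<open>r = 0\<close>. By the equation its
  derivative in \<open>r\<close> vanishes there as well, so replacing it by zero for \<open>r \<le> 0\<close> gives another
  \<open>C\<^sup>1\<close> solution, which is zero on a nonempty open set. The parameter domain \<open>D\<close> is connected
  because \<open>\<Omega>\<close> is connected and reaches \<open>r = 0\<close>, and the identity theorem
  (\<open>slice_identity_theorem\<close>) yields \<open>f = k\<close>.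

  For the identity theorem a solution \<open>F\<close> on the slice through \<open>\<omega>\<close> is turned into the function
  \<open>U y = F (x, y \<bullet> \<omega>)\<close> of all eight coordinates, where \<open>x\<close> is the projection of \<open>y\<close> to
  \<open>paravecs p\<close>. It satisfies the Dirac equation \<open>(\<Sum>b\<in>Basis. b \<odot> \<partial>\<^sub>b U) = 0\<close>, whatever \<open>p\<close>
  and \<open>\<omega>\<close> are, and in the even dimension 8 the Cauchy kernel of this equation,
  up to a constant \<open>oct_conj w / |w|\<^sup>8\<close>, is a rational function. The local statement is that a
  solution on a ball which is zero near the centre is zero on the ball
  (\<open>monogenic_zero_near_center_imp_zero_on_ball\<close>). A cutoff and integration by parts represent
  the solution as the integral of the Cauchy kernel against a function that lives in an annulus.
  Along a segment from the centre that does not reach the annulus this integral extends to a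
  holomorphic function, which is zero near the centre and hence along the segment.
\<close>

section \<open>Octonion arithmetic\<close>

lemma atMost_7: "{..7::nat} = {0,1,2,3,4,5,6,7}" by auto

lemma atLeastAtMost_1_7: "{1..7::nat} = {1,2,3,4,5,6,7}" by auto

lemma UNIV_8: "(UNIV :: 8 set) = {0,1,2,3,4,5,6,7}"
proof (rule card_subset_eq[symmetric])
  show "card {0,1,2,3,4,5,6,7::8} = card (UNIV :: 8 set)" by simp
qed auto

lemma oct_mult_nth_sum:
  "(x \<odot> y) $ k = (\<Sum>i\<in>{0,1,2,3,4,5,6,7}. \<Sum>j\<in>{0,1,2,3,4,5,6,7}. (x $ of_nat i * y $ of_nat j) * oct_e_prod i j $ k)"
  unfolding oct_mult_def atMost_7 by (simp only: sum_component vector_scaleR_component real_scaleR_def)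

lemma oct_e_prod_0: "oct_e_prod 0 j = oct_e j" "oct_e_prod i 0 = oct_e i"
  by (simp_all add: oct_e_prod_def)

lemma oct_e_prod_table:
  "oct_e_prod 1 1 = - oct_e 0" "oct_e_prod 1 2 = oct_e 3" "oct_e_prod 1 3 = - oct_e 2" "oct_e_prod 1 4 = oct_e 5"
  "oct_e_prod 1 5 = - oct_e 4" "oct_e_prod 1 6 = - oct_e 7" "oct_e_prod 1 7 = oct_e 6"
  "oct_e_prod 2 1 = - oct_e 3" "oct_e_prod 2 2 = - oct_e 0" "oct_e_prod 2 3 = oct_e 1" "oct_e_prod 2 4 = oct_e 6"
  "oct_e_prod 2 5 = oct_e 7" "oct_e_prod 2 6 = - oct_e 4" "oct_e_prod 2 7 = - oct_e 5"
  "oct_e_prod 3 1 = oct_e 2" "oct_e_prod 3 2 = - oct_e 1" "oct_e_prod 3 3 = - oct_e 0" "oct_e_prod 3 4 = oct_e 7"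
  "oct_e_prod 3 5 = - oct_e 6" "oct_e_prod 3 6 = oct_e 5" "oct_e_prod 3 7 = - oct_e 4"
  "oct_e_prod 4 1 = - oct_e 5" "oct_e_prod 4 2 = - oct_e 6" "oct_e_prod 4 3 = - oct_e 7" "oct_e_prod 4 4 = - oct_e 0"
  "oct_e_prod 4 5 = oct_e 1" "oct_e_prod 4 6 = oct_e 2" "oct_e_prod 4 7 = oct_e 3"
  "oct_e_prod 5 1 = oct_e 4" "oct_e_prod 5 2 = - oct_e 7" "oct_e_prod 5 3 = oct_e 6" "oct_e_prod 5 4 = - oct_e 1"
  "oct_e_prod 5 5 = - oct_e 0" "oct_e_prod 5 6 = - oct_e 3" "oct_e_prod 5 7 = oct_e 2"
  "oct_e_prod 6 1 = oct_e 7" "oct_e_prod 6 2 = oct_e 4" "oct_e_prod 6 3 = - oct_e 5" "oct_e_prod 6 4 = - oct_e 2"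
  "oct_e_prod 6 5 = oct_e 3" "oct_e_prod 6 6 = - oct_e 0" "oct_e_prod 6 7 = - oct_e 1"
  "oct_e_prod 7 1 = - oct_e 6" "oct_e_prod 7 2 = oct_e 5" "oct_e_prod 7 3 = oct_e 4" "oct_e_prod 7 4 = - oct_e 3"
  "oct_e_prod 7 5 = - oct_e 2" "oct_e_prod 7 6 = oct_e 1" "oct_e_prod 7 7 = - oct_e 0"
  unfolding oct_e_prod_def atLeastAtMost_1_7 oct_eps_def oct_triples_def
  by simp_all

lemma oct_mult_nth:
  "(x \<odot> y) $ 0 = x$0*y$0 - x$1*y$1 - x$2*y$2 - x$3*y$3 - x$4*y$4 - x$5*y$5 - x$6*y$6 - x$7*y$7"
  "(x \<odot> y) $ 1 = x$0*y$1 + x$1*y$0 + x$2*y$3 - x$3*y$2 + x$4*y$5 - x$5*y$4 - x$6*y$7 + x$7*y$6"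
  "(x \<odot> y) $ 2 = x$0*y$2 - x$1*y$3 + x$2*y$0 + x$3*y$1 + x$4*y$6 + x$5*y$7 - x$6*y$4 - x$7*y$5"
  "(x \<odot> y) $ 3 = x$0*y$3 + x$1*y$2 - x$2*y$1 + x$3*y$0 + x$4*y$7 - x$5*y$6 + x$6*y$5 - x$7*y$4"
  "(x \<odot> y) $ 4 = x$0*y$4 - x$1*y$5 - x$2*y$6 - x$3*y$7 + x$4*y$0 + x$5*y$1 + x$6*y$2 + x$7*y$3"
  "(x \<odot> y) $ 5 = x$0*y$5 + x$1*y$4 - x$2*y$7 + x$3*y$6 - x$4*y$1 + x$5*y$0 - x$6*y$3 + x$7*y$2"
  "(x \<odot> y) $ 6 = x$0*y$6 + x$1*y$7 + x$2*y$4 - x$3*y$5 - x$4*y$2 + x$5*y$3 + x$6*y$0 - x$7*y$1"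
  "(x \<odot> y) $ 7 = x$0*y$7 - x$1*y$6 + x$2*y$5 + x$3*y$4 - x$4*y$3 - x$5*y$2 + x$6*y$1 + x$7*y$0"
  by (subst oct_mult_nth_sum,
    simp only: sum.insert finite.intros sum.empty insert_iff empty_iff zero_neq_one
      numeral_eq_iff num.simps simp_thms zero_neq_numeral one_eq_numeral_iff
      oct_e_prod_0 oct_e_prod_table,
    simp only: oct_e_def axis_def of_nat_0 of_nat_1 of_nat_numeral vector_uminus_component,
    simp)+

definition oct_conj :: "oct \<Rightarrow> oct"
  where "oct_conj x = (2 * x $ 0) *\<^sub>R oct_e 0 - x"

lemma forall_8: "(\<forall>k::8. P k) \<longleftrightarrow> P 0 \<and> P 1 \<and> P 2 \<and> P 3 \<and> P 4 \<and> P 5 \<and> P 6 \<and> P 7"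
proof -
  have "(\<forall>k::8. P k) \<longleftrightarrow> (\<forall>k\<in>UNIV. P k)" by simp
  then show ?thesis unfolding UNIV_8 by simp
qed

lemma oct_conj_nth: "oct_conj x $ 0 = x $ 0" "k \<noteq> 0 \<Longrightarrow> oct_conj x $ k = - x $ k"
  by (simp_all add: oct_conj_def oct_e_def axis_def)

lemma inner_8: "w \<bullet> w = w$0*w$0 + w$1*w$1 + w$2*w$2 + w$3*w$3 + w$4*w$4 + w$5*w$5 + w$6*w$6 + w$7*w$7"
  for w :: oct
  unfolding inner_vec_def UNIV_8 by simp

text \<open>
  This takes the place of associativity throughout: left multiplication by \<open>oct_conj w\<close> is,
  up to the factor \<open>w \<bullet> w\<close>, a left inverse of left multiplication by \<open>w\<close>. In coordinates it is a
  polynomial identity.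
\<close>

lemma oct_conj_mult_cancel: "oct_conj w \<odot> (w \<odot> a) = (w \<bullet> w) *\<^sub>R a"
  unfolding vec_eq_iff forall_8
  by (simp add: oct_mult_nth oct_conj_nth inner_8) (intro conjI; algebra)

lemma bounded_bilinear_oct_mult: "bounded_bilinear (\<odot>)"
proof -
  have "linear (\<lambda>x. x \<odot> y)" for y
    by (rule linearI) (simp_all add: oct_mult_def algebra_simps sum.distrib scaleR_sum_right)
  moreover have "linear (\<lambda>y. x \<odot> y)" for x
    by (rule linearI) (simp_all add: oct_mult_def algebra_simps sum.distrib scaleR_sum_right)
  ultimately show ?thesis
    by (simp add: bilinear_def flip: bilinear_conv_bounded_bilinear)
qed

interpretation oct: bounded_bilinear "(\<odot>)"
  by (rule bounded_bilinear_oct_mult)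

lemma linear_oct_conj: "linear oct_conj"
  by (rule linearI) (simp_all add: oct_conj_def algebra_simps)

text \<open>
  The Clifford relation for left multiplications. For orthogonal imaginary octonions it says that
  their left multiplications anticommute.
\<close>

lemma oct_conj_mult_polarized:
  "oct_conj x \<odot> (y \<odot> a) + oct_conj y \<odot> (x \<odot> a) = (2 * (x \<bullet> y)) *\<^sub>R a"
proof -
  have "oct_conj (x + y) \<odot> ((x + y) \<odot> a) = ((x + y) \<bullet> (x + y)) *\<^sub>R a"
    by (rule oct_conj_mult_cancel)
  then show ?thesis
    by (simp add: linear_add[OF linear_oct_conj] oct.add_left oct.add_right oct_conj_mult_cancel
        inner_add_left inner_add_right inner_commute algebra_simps)
qed

section \<open>Calculus of several real variables\<close>

text \<open>
  Integration by parts. The integral of \<open>f (y + t *\<^sub>R e)\<close> over a box that contains the support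
  with some room to spare does not depend on \<open>t\<close> for small \<open>t\<close>, and its derivative at
  \<open>t = 0\<close> is the integral of \<open>f'\<close>.
\<close>

lemma integral_directional_derivative_zero:
  fixes f f' :: "'a::euclidean_space \<Rightarrow> 'b::euclidean_space"
  assumes deriv: "\<And>y. ((\<lambda>t. f (y + t *\<^sub>R e)) has_vector_derivative f' y) (at 0)"
    and cont: "continuous_on UNIV f" "continuous_on UNIV f'"
    and supp: "\<And>y. y \<notin> cbox a b \<Longrightarrow> f y = 0"
  shows "integral (cbox a b) f' = 0"
proof -
  obtain M where M: "\<And>y. y \<in> cbox a b \<Longrightarrow> norm y \<le> M"
    using bounded_cbox[of a b] by (auto simp: bounded_iff)
  \<comment> \<open>The larger box contains the translates of the support by \<open>t *\<^sub>R e\<close> for \<open>\<bar>t\<bar> \<le> 1\<close>.\<close>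
  obtain c :: 'a where c: "cball 0 (M + norm e) \<subseteq> cbox (- c) c"
    using bounded_subset_cbox_symmetric[OF bounded_cball] by metis
  have f0: "f y = 0" if "norm y > M" for y
    using M supp that by force
  have cover: "integral (cbox (-c) c) g = integral (cbox a b) g" if "\<And>y. y \<notin> cbox a b \<Longrightarrow> g y = 0"
    for g :: "'a \<Rightarrow> 'b"
  proof -
    have "cbox a b \<subseteq> cbox (-c) c"
    proof
      fix y assume "y \<in> cbox a b"
      then have "norm y \<le> M + norm e" using M[of y] norm_ge_zero[of e] by linarith
      then show "y \<in> cbox (-c) c" using c by auto
    qed
    then have "integral (cbox (-c) c) (\<lambda>y. if y \<in> cbox a b then g y else 0) = integral (cbox a b) g"
      by (simp add: integral_restrict_Int Int_absorb2)
    moreover have "(\<lambda>y. if y \<in> cbox a b then g y else 0) = g" using that by auto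
    ultimately show ?thesis by simp
  qed
  define I where "I t = integral (cbox (-c) c) (\<lambda>y. f (y + t *\<^sub>R e))" for t
  have shift: "I t = integral UNIV f" if "\<bar>t\<bar> \<le> 1" for t
  proof -
    have "f y = 0" if "y \<notin> cbox (-c + t *\<^sub>R e) (c + t *\<^sub>R e)" for y
    proof (rule f0)
      have "y - t *\<^sub>R e \<notin> cbox (-c) c"
        using that by (simp add: mem_box algebra_simps)
      then have "norm (y - t *\<^sub>R e) > M + norm e" using c by (force simp: subset_iff not_le[symmetric])
      moreover have "norm (y - t *\<^sub>R e) \<le> norm y + norm e"
        using norm_triangle_ineq4[of y "t *\<^sub>R e"] \<open>\<bar>t\<bar> \<le> 1\<close>
          mult_right_mono[of "\<bar>t\<bar>" 1 "norm e"] by simp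
      ultimately show "norm y > M" by simp
    qed
    then have "(\<lambda>y. if y \<in> cbox (-c + t *\<^sub>R e) (c + t *\<^sub>R e) then f y else 0) = f" by auto
    then have "integral UNIV f = integral (cbox (-c + t *\<^sub>R e) (c + t *\<^sub>R e)) f"
      using integral_restrict_UNIV[of "cbox (-c + t *\<^sub>R e) (c + t *\<^sub>R e)" f] by simp
    also have "\<dots> = I t"
      unfolding integral_shift_cbox_plus[symmetric] I_def by (simp add: o_def add.commute)
    finally show ?thesis by simp
  qed
  have "((\<lambda>t. integral (cbox (-c) c) (\<lambda>y. f (y + t *\<^sub>R e))) has_vector_derivative
      integral (cbox (-c) c) (\<lambda>y. f' (y + 0 *\<^sub>R e))) (at 0 within UNIV)"
  proof (rule leibniz_rule_vector_derivative)
    fix t y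
    have "((\<lambda>s. f (y + t *\<^sub>R e + s *\<^sub>R e)) \<circ> (\<lambda>s. s - t) has_vector_derivative 1 *\<^sub>R f' (y + t *\<^sub>R e)) (at t)"
      by (rule vector_diff_chain_at) (auto intro!: derivative_eq_intros deriv)
    then show "((\<lambda>t. f (y + t *\<^sub>R e)) has_vector_derivative f' (y + t *\<^sub>R e)) (at t within UNIV)"
      by (simp add: o_def algebra_simps)
  next
    show "(\<lambda>y. f (y + t *\<^sub>R e)) integrable_on cbox (-c) c" for t
      by (intro integrable_continuous continuous_on_compose2[OF cont(1)] continuous_intros) auto
    show "continuous_on (UNIV \<times> cbox (-c) c) (\<lambda>(t, y). f' (y + t *\<^sub>R e))"
      unfolding split_beta
      by (intro continuous_on_compose2[OF cont(2)] continuous_intros) auto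
  qed auto
  then have D: "(I has_vector_derivative integral (cbox (-c) c) f') (at 0)"
    unfolding I_def by simp
  have "(I has_vector_derivative 0) (at 0)"
    by (rule has_vector_derivative_transform_within_open[where S="{-1<..<1}" and f="\<lambda>_. integral UNIV f"])
      (auto simp: shift)
  with D have "integral (cbox (-c) c) f' = 0"
    using vector_derivative_unique_at by blast
  moreover have "f' y = 0" if "y \<notin> cbox a b" for y
  proof -
    have "open ((\<lambda>t. y + t *\<^sub>R e) -` (- cbox a b))"
      by (intro open_vimage continuous_intros open_Compl closed_cbox)
    then have "((\<lambda>t. f (y + t *\<^sub>R e)) has_vector_derivative 0) (at 0)"
      using that supp
      by - (rule has_vector_derivative_transform_within_open[where f="\<lambda>_. 0"
            and S="(\<lambda>t. y + t *\<^sub>R e) -` (- cbox a b)"], auto)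
    with deriv show ?thesis using vector_derivative_unique_at by blast
  qed
  ultimately show ?thesis using cover by simp
qed

text \<open>
  The function \<open>m s = (max 0 s)\<^sup>2\<close> is continuously differentiable. Composed with itself and
  affine maps it gives a cutoff.
\<close>

lemma C1_cutoff:
  fixes a b :: real
  assumes "a < b"
  obtains \<kappa> \<kappa>' where "\<And>s. (\<kappa> has_real_derivative \<kappa>' s) (at s)" "continuous_on UNIV \<kappa>'"
    "\<And>s. s \<le> a \<Longrightarrow> \<kappa> s = 1" "\<And>s. s \<le> a \<Longrightarrow> \<kappa>' s = 0" "\<And>s. s \<ge> b \<Longrightarrow> \<kappa> s = 0" "\<And>s. s \<ge> b \<Longrightarrow> \<kappa>' s = 0"
proof -
  define m :: "real \<Rightarrow> real" where "m s = (max 0 s)\<^sup>2" for s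
  define q where "q s = (s - a) / (b - a)" for s
  have m: "(m has_real_derivative 2 * max 0 s) (at s)" for s
  proof (cases s "0::real" rule: linorder_cases)
    case less
    have "((\<lambda>_. 0) has_real_derivative 0) (at s)" by simp
    then show ?thesis using less
      by - (rule has_field_derivative_transform_within_open[where S="{..<0}" and f="\<lambda>_. 0"],
        auto simp: m_def)
  next
    case equal
    have "(m has_real_derivative 0) (at 0)"
      unfolding DERIV_def
    proof (rule Lim_null_comparison)
      show "\<forall>\<^sub>F h in at 0. norm ((m (0 + h) - m 0) / h) \<le> \<bar>h\<bar>"
        by (auto simp: m_def max_def power2_eq_square eventually_at_filter)
      show "((\<lambda>h. \<bar>h\<bar>) \<longlongrightarrow> 0) (at (0::real))"
        by (auto intro!: tendsto_eq_intros)
    qed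
    then show ?thesis using equal by simp
  next
    case greater
    have "((\<lambda>s. s\<^sup>2) has_real_derivative 2 * s) (at s)"
      by (auto intro!: derivative_eq_intros)
    then have "(m has_real_derivative 2 * s) (at s)"
      by (rule has_field_derivative_transform_within_open[where S="{0<..}"])
        (use greater in \<open>auto simp: m_def\<close>)
    then show ?thesis using greater by simp
  qed
  define \<kappa> where "\<kappa> s = m (1 - m (q s))" for s
  define \<kappa>' where "\<kappa>' s = - (2 * max 0 (1 - m (q s)) * (2 * max 0 (q s) * (1 / (b - a))))" for s
  have q: "(q has_real_derivative 1 / (b - a)) (at s)" for s
    unfolding q_def by (rule DERIV_cdivide) (auto intro!: derivative_eq_intros)
  show thesis
  proof (rule that[of \<kappa> \<kappa>'])
    show "(\<kappa> has_real_derivative \<kappa>' s) (at s)" for s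
      using DERIV_chain2[OF m DERIV_diff[OF DERIV_const DERIV_chain2[OF m q]]]
      unfolding \<kappa>_def \<kappa>'_def by simp
    have "continuous_on UNIV m" "continuous_on UNIV q"
      by (rule DERIV_continuous_on, rule m, rule DERIV_continuous_on, rule q)
    then show "continuous_on UNIV \<kappa>'"
      unfolding \<kappa>'_def by (intro continuous_intros continuous_on_compose2[of UNIV m _ q]) auto
    show "\<kappa> s = 1" "\<kappa>' s = 0" if "s \<le> a" for s
    proof -
      have "max 0 (q s) = 0" using that assms by (simp add: q_def divide_nonpos_pos)
      then show "\<kappa> s = 1" "\<kappa>' s = 0" by (simp_all add: \<kappa>_def \<kappa>'_def m_def)
    qed
    show "\<kappa> s = 0" "\<kappa>' s = 0" if "s \<ge> b" for s
    proof -
      have "q s \<ge> 1" using that assms by (simp add: q_def field_simps)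
      then have "m (q s) \<ge> 1" by (simp add: m_def)
      then show "\<kappa> s = 0" "\<kappa>' s = 0" by (simp_all add: \<kappa>_def \<kappa>'_def m_def)
    qed
  qed
qed

text \<open>
  The singularity of the kernel at \<open>\<epsilon> = 0\<close> and \<open>y = x\<close> is harmless because \<open>H\<close> vanishes near
  \<open>x\<close>. Bounding \<open>norm (y - x)\<close> below by \<open>\<delta>\<close> inside the kernel changes no value of the integrand
  and makes it jointly continuous.
\<close>

lemma continuous_kernel_integral:
  fixes H :: "'a::euclidean_space \<Rightarrow> 'b::euclidean_space"
  assumes "continuous_on UNIV H" "\<delta> > 0" "\<And>y. norm (y - x) < \<delta> \<Longrightarrow> H y = 0"
  shows "continuous_on {0..} (\<lambda>\<epsilon>. integral (cbox a b) (\<lambda>y. (1 / ((norm (y - x))\<^sup>2 + \<epsilon>) ^ n) *\<^sub>R H y))"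
proof -
  have pos: "max (\<delta>\<^sup>2) ((norm (y - x))\<^sup>2) > 0" for y
    using assms(2) by (simp add: less_max_iff_disj)
  have "continuous_on {0..} (\<lambda>\<epsilon>. integral (cbox a b)
      (\<lambda>y. (1 / (max (\<delta>\<^sup>2) ((norm (y - x))\<^sup>2) + \<epsilon>) ^ n) *\<^sub>R H y))"
  proof (rule integral_continuous_on_param)
    show "continuous_on ({0..} \<times> cbox a b)
        (\<lambda>(\<epsilon>, y). (1 / (max (\<delta>\<^sup>2) ((norm (y - x))\<^sup>2) + \<epsilon>) ^ n) *\<^sub>R H y)"
      unfolding split_beta using pos
      by (intro continuous_intros continuous_on_compose2[OF assms(1)])
        (auto simp: add_pos_nonneg less_imp_neq[symmetric])
  qed
  moreover have "(1 / (max (\<delta>\<^sup>2) ((norm (y - x))\<^sup>2) + \<epsilon>) ^ n) *\<^sub>R H y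
      = (1 / ((norm (y - x))\<^sup>2 + \<epsilon>) ^ n) *\<^sub>R H y" for y \<epsilon>
  proof (cases "norm (y - x) < \<delta>")
    case False
    then have "\<delta>\<^sup>2 \<le> (norm (y - x))\<^sup>2" using assms(2) by (intro power_mono) auto
    then show ?thesis by (simp add: max_def)
  qed (simp add: assms(3))
  ultimately show ?thesis by simp
qed

text \<open>
  Near a point the partial derivatives are bounded, so that moving in one coordinate after the
  other yields a Lipschitz estimate.
\<close>

lemma continuous_on_of_continuous_partials:
  fixes U :: "'a::euclidean_space \<Rightarrow> 'b::real_normed_vector" and U' :: "'a \<Rightarrow> 'a \<Rightarrow> 'b"
  assumes W: "open W"
    and deriv: "\<And>y b. y \<in> W \<Longrightarrow> b \<in> Basis \<Longrightarrow> ((\<lambda>t. U (y + t *\<^sub>R b)) has_vector_derivative U' b y) (at 0)"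
    and cont: "\<And>b. b \<in> Basis \<Longrightarrow> continuous_on W (U' b)"
  shows "continuous_on W U"
  unfolding continuous_on_eq_continuous_at[OF W]
proof
  fix x assume x: "x \<in> W"
  define g where "g y = (\<Sum>b\<in>Basis. norm (U' b y))" for y
  have "continuous_on W g" unfolding g_def by (intro continuous_intros cont)
  then have "open (W \<inter> g -` {..<g x + 1})"
    using W by (intro continuous_open_preimage) auto
  moreover have "x \<in> W \<inter> g -` {..<g x + 1}" using x by simp
  ultimately obtain \<rho> where \<rho>: "\<rho> > 0" "ball x \<rho> \<subseteq> W \<inter> g -` {..<g x + 1}"
    using open_contains_ball by metis
  define M where "M = g x + 1"
  have "norm (U' b y) \<le> M" if "y \<in> ball x \<rho>" "b \<in> Basis" for y b
  proof -
    have "norm (U' b y) \<le> g y" unfolding g_def by (rule member_le_sum) (use that in auto)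
    also have "\<dots> < M" using \<rho>(2) that by (auto simp: M_def)
    finally show ?thesis by simp
  qed
  note M = this
  have step: "norm (U (z + \<tau> *\<^sub>R b) - U z) \<le> M * \<bar>\<tau>\<bar>"
    if b: "b \<in> Basis" and seg: "\<And>t. \<bar>t\<bar> \<le> \<bar>\<tau>\<bar> \<Longrightarrow> z + t *\<^sub>R b \<in> ball x \<rho>" for z b \<tau>
  proof -
    have d: "((\<lambda>t. U (z + t *\<^sub>R b)) has_derivative (\<lambda>h. h *\<^sub>R U' b (z + t *\<^sub>R b)))
        (at t within {-\<bar>\<tau>\<bar>..\<bar>\<tau>\<bar>})" if "t \<in> {-\<bar>\<tau>\<bar>..\<bar>\<tau>\<bar>}" for t
    proof -
      have "z + t *\<^sub>R b \<in> W" using seg[of t] that \<rho>(2) by auto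
      note D = deriv[OF this b]
      have "((\<lambda>s. U (z + t *\<^sub>R b + s *\<^sub>R b)) \<circ> (\<lambda>s. s - t) has_vector_derivative 1 *\<^sub>R U' b (z + t *\<^sub>R b)) (at t)"
        by (rule vector_diff_chain_at) (use D in \<open>auto intro!: derivative_eq_intros\<close>)
      then have "((\<lambda>t. U (z + t *\<^sub>R b)) has_vector_derivative U' b (z + t *\<^sub>R b)) (at t)"
        by (simp add: o_def algebra_simps)
      then show ?thesis
        unfolding has_vector_derivative_def by (rule has_derivative_at_withinI)
    qed
    have "norm (U (z + \<tau> *\<^sub>R b) - U (z + 0 *\<^sub>R b)) \<le> M * norm (\<tau> - 0)"
    proof (rule differentiable_bound[OF _ d])
      fix t assume "t \<in> {-\<bar>\<tau>\<bar>..\<bar>\<tau>\<bar>}"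
      then have "norm (U' b (z + t *\<^sub>R b)) \<le> M" using seg[of t] by (intro M b) auto
      then show "onorm (\<lambda>h. h *\<^sub>R U' b (z + t *\<^sub>R b)) \<le> M"
        by (intro onorm_le) (simp add: mult.commute[of M] mult_left_mono)
    qed auto
    then show ?thesis by simp
  qed
  have M0: "M > 0" unfolding M_def g_def by (rule add_nonneg_pos) (auto intro!: sum_nonneg)
  have chain: "norm (U (x + (\<Sum>b\<in>S. (w \<bullet> b) *\<^sub>R b)) - U x) \<le> (\<Sum>b\<in>S. M * \<bar>w \<bullet> b\<bar>)"
    if w: "(\<Sum>b\<in>Basis. \<bar>w \<bullet> b\<bar>) < \<rho>" and "S \<subseteq> Basis" for w S
    using finite_subset[OF \<open>S \<subseteq> Basis\<close> finite_Basis] \<open>S \<subseteq> Basis\<close>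
  proof (induction S rule: finite_induct)
    case (insert c S)
    define z where "z = x + (\<Sum>b\<in>S. (w \<bullet> b) *\<^sub>R b)"
    have "norm (U (z + (w \<bullet> c) *\<^sub>R c) - U z) \<le> M * \<bar>w \<bullet> c\<bar>"
    proof (rule step)
      fix t :: real assume t: "\<bar>t\<bar> \<le> \<bar>w \<bullet> c\<bar>"
      have "norm ((\<Sum>b\<in>S. (w \<bullet> b) *\<^sub>R b) + t *\<^sub>R c) \<le> (\<Sum>b\<in>S. norm ((w \<bullet> b) *\<^sub>R b)) + norm (t *\<^sub>R c)"
        by (intro order_trans[OF norm_triangle_ineq] add_right_mono norm_sum)
      also have "\<dots> \<le> (\<Sum>b\<in>S. \<bar>w \<bullet> b\<bar>) + \<bar>w \<bullet> c\<bar>"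
        using insert.prems t by (intro add_mono sum_mono) (auto simp: subset_iff)
      also have "\<dots> = (\<Sum>b\<in>insert c S. \<bar>w \<bullet> b\<bar>)" using insert.hyps by simp
      also have "\<dots> \<le> (\<Sum>b\<in>Basis. \<bar>w \<bullet> b\<bar>)" using insert.prems by (intro sum_mono2) auto
      finally have "norm (z + t *\<^sub>R c - x) < \<rho>"
        using w by (simp add: z_def add.assoc)
      then show "z + t *\<^sub>R c \<in> ball x \<rho>"
        by (metis mem_ball dist_commute dist_norm)
    qed (use insert.prems in auto)
    moreover have "norm (U z - U x) \<le> (\<Sum>b\<in>S. M * \<bar>w \<bullet> b\<bar>)"
      unfolding z_def using insert.prems by (intro insert.IH) auto
    ultimately have "norm (U (z + (w \<bullet> c) *\<^sub>R c) - U x) \<le> M * \<bar>w \<bullet> c\<bar> + (\<Sum>b\<in>S. M * \<bar>w \<bullet> b\<bar>)"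
      using norm_triangle_le[of "U (z + (w \<bullet> c) *\<^sub>R c) - U z" "U z - U x"] by simp
    then show ?case using insert.hyps by (simp add: z_def algebra_simps)
  qed simp
  have "((\<lambda>y. U y - U x) \<longlongrightarrow> 0) (at x)"
  proof (rule Lim_null_comparison)
    have "((\<lambda>y. (\<Sum>b\<in>Basis. \<bar>(y - x) \<bullet> b\<bar>)) \<longlongrightarrow> (\<Sum>b\<in>(Basis::'a set). \<bar>(x - x) \<bullet> b\<bar>)) (at x)"
      by (intro tendsto_intros)
    then have "((\<lambda>y. (\<Sum>b\<in>Basis. \<bar>(y - x) \<bullet> b\<bar>)) \<longlongrightarrow> 0) (at x)" by simp
    then have "\<forall>\<^sub>F y in at x. (\<Sum>b\<in>Basis. \<bar>(y - x) \<bullet> b\<bar>) < \<rho>"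
      using \<rho>(1) order_tendstoD(2) by blast
    then show "\<forall>\<^sub>F y in at x. norm (U y - U x) \<le> (\<Sum>b\<in>Basis. M * \<bar>(y - x) \<bullet> b\<bar>)"
    proof eventually_elim
      case (elim y)
      from chain[OF elim subset_refl] show ?case by (simp only: euclidean_representation) simp
    qed
    have "((\<lambda>y. (\<Sum>b\<in>Basis. M * \<bar>(y - x) \<bullet> b\<bar>)) \<longlongrightarrow> (\<Sum>b\<in>(Basis::'a set). M * \<bar>(x - x) \<bullet> b\<bar>)) (at x)"
      by (intro tendsto_intros)
    then show "((\<lambda>y. (\<Sum>b\<in>Basis. M * \<bar>(y - x) \<bullet> b\<bar>)) \<longlongrightarrow> 0) (at x)" by simp
  qed
  then show "continuous (at x) U" by (simp add: continuous_at LIM_zero_iff)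
qed

section \<open>Integrals against singular kernels\<close>

text \<open>
  For real \<open>z\<close> the expression is \<open>(norm (w - z *\<^sub>R h))\<^sup>2\<close> with \<open>a = norm w\<close>, \<open>c = norm h\<close> and
  \<open>\<beta> = h \<bullet> w\<close>. As a polynomial in \<open>z\<close> it has real coefficients and nonpositive discriminant, so
  that for \<open>c > 0\<close> both of its roots have modulus \<open>a / c\<close>.
\<close>

lemma complexified_sq_distance_nonzero:
  fixes z :: complex and a c \<beta> :: real
  assumes a: "a > 0" and c: "c \<ge> 0" and \<beta>: "\<bar>\<beta>\<bar> \<le> a * c" and z: "norm z * c < a"
  shows "of_real (a\<^sup>2) - 2 * z * of_real \<beta> + z\<^sup>2 * of_real (c\<^sup>2) \<noteq> 0"
proof
  assume 0: "of_real (a\<^sup>2) - 2 * z * of_real \<beta> + z\<^sup>2 * of_real (c\<^sup>2) = 0"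
  define p q where "p = Re z" and "q = Im z"
  have zc: "(p\<^sup>2 + q\<^sup>2) * c\<^sup>2 < a\<^sup>2"
  proof -
    have "(norm z * c)\<^sup>2 < a\<^sup>2" using z c by (intro power_strict_mono) auto
    then show ?thesis by (simp add: power_mult_distrib cmod_power2 p_def q_def)
  qed
  have "Re (of_real (a\<^sup>2) - 2 * z * of_real \<beta> + z\<^sup>2 * of_real (c\<^sup>2)) = 0"
    "Im (of_real (a\<^sup>2) - 2 * z * of_real \<beta> + z\<^sup>2 * of_real (c\<^sup>2)) = 0"
    using 0 by simp_all
  then have re: "a\<^sup>2 - 2 * p * \<beta> + (p\<^sup>2 - q\<^sup>2) * c\<^sup>2 = 0" and im: "q * (p * c\<^sup>2 - \<beta>) = 0"
    by (simp_all add: p_def q_def power2_eq_square algebra_simps)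
  from im consider "q = 0" | "\<beta> = p * c\<^sup>2" by auto
  then show False
  proof cases
    case 1
    have "2 * p * \<beta> \<le> 2 * \<bar>p\<bar> * (a * c)"
      using mult_left_mono[OF \<beta>, of "\<bar>p\<bar>"] abs_le_D1[of "p * \<beta>"] by (auto simp: abs_mult)
    moreover have "a\<^sup>2 + p\<^sup>2 * c\<^sup>2 = 2 * p * \<beta>" using re 1 by simp
    ultimately have "(a - \<bar>p\<bar> * c)\<^sup>2 \<le> 0"
      by (simp add: power2_diff power_mult_distrib algebra_simps)
    then have "a = \<bar>p\<bar> * c" by simp
    then have "a\<^sup>2 = p\<^sup>2 * c\<^sup>2" by (simp add: power_mult_distrib)
    with zc 1 show False by simp
  next
    case 2
    then have "a\<^sup>2 = (p\<^sup>2 + q\<^sup>2) * c\<^sup>2" using re by (simp add: power2_eq_square algebra_simps)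
    with zc show False by simp
  qed
qed

text \<open>
  The integrand with \<open>t\<close> in place of 1 is a rational function of \<open>t\<close>. Its poles have modulus
  greater than 1 for all \<open>y\<close> outside the ball where \<open>A\<close> and \<open>B\<close> vanish, uniformly in \<open>y\<close>.
  So the integral extends to a holomorphic function of \<open>t\<close> on a disc that contains 1, and the
  identity theorem applies.
\<close>

lemma kernel_integral_zero_along_segment:
  fixes v h :: "'a::euclidean_space" and A B :: "'a \<Rightarrow> real"
  assumes cont: "continuous_on UNIV A" "continuous_on UNIV B"
    and vanish: "\<And>y. norm (y - v) < r \<Longrightarrow> A y = 0" "\<And>y. norm (y - v) < r \<Longrightarrow> B y = 0"
    and h: "norm h < r" and "\<delta> > 0"
    and zero: "\<And>t. 0 < t \<Longrightarrow> t < \<delta> \<Longrightarrow>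
      integral (cbox a b) (\<lambda>y. (A y + t * B y) / ((norm (y - (v + t *\<^sub>R h)))\<^sup>2) ^ n) = 0"
  shows "integral (cbox a b) (\<lambda>y. (A y + B y) / ((norm (y - (v + h)))\<^sup>2) ^ n) = 0"
proof -
  \<comment> \<open>Any radius with \<open>\<rho> > 1\<close> and \<open>\<rho> * norm h < r\<close> serves; this one covers \<open>h = 0\<close> too.\<close>
  define \<rho> where "\<rho> = 1 + (r - norm h) / (norm h + 1)"
  have h1: "0 < norm h + 1" using norm_ge_zero[of h] by linarith
  have \<rho>1: "\<rho> > 1" using h h1 by (simp add: \<rho>_def)
  have "norm h / (norm h + 1) < 1" using h1 by (simp add: divide_less_eq)
  then have "(r - norm h) * (norm h / (norm h + 1)) < (r - norm h) * 1"
    using h by (intro mult_strict_left_mono) auto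
  then have \<rho>h: "\<rho> * norm h < r" by (simp add: \<rho>_def distrib_right)
  define U where "U = ball (0::complex) \<rho>"
  define q where "q z y = of_real ((norm (y - v))\<^sup>2) - 2 * z * of_real (h \<bullet> (y - v))
      + z\<^sup>2 * of_real ((norm h)\<^sup>2)" for z :: complex and y
  define q' where "q' z y = - (2 * of_real (h \<bullet> (y - v))) + 2 * z * of_real ((norm h)\<^sup>2)"
    for z :: complex and y
  define f where "f z y = (of_real (A y) + z * of_real (B y)) / q z y ^ n" for z :: complex and y
  define f' where "f' z y = (of_real (B y) * q z y ^ n
      - (of_real (A y) + z * of_real (B y)) * (of_nat n * (q' z y * q z y ^ (n - 1)))) / (q z y ^ n * q z y ^ n)"
    for z :: complex and y
  have zU: "norm z * norm h < r" if "z \<in> U" for z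
  proof -
    have "norm z * norm h \<le> \<rho> * norm h" using that by (intro mult_right_mono) (auto simp: U_def)
    with \<rho>h show ?thesis by simp
  qed
  have q0: "q z y \<noteq> 0" if "norm z * norm h < norm (y - v)" for z y
    unfolding q_def
  proof (rule complexified_sq_distance_nonzero)
    show "\<bar>h \<bullet> (y - v)\<bar> \<le> norm (y - v) * norm h"
      using Cauchy_Schwarz_ineq2[of h "y - v"] by (simp add: mult.commute)
    show "0 < norm (y - v)" by (rule le_less_trans[OF _ that]) simp
  qed (use that in auto)
  have deriv: "((\<lambda>z. f z y) has_field_derivative f' z y) (at z within U)" if "z \<in> U" for z y
  proof (cases "norm (y - v) < r")
    case True
    then show ?thesis by (simp add: f_def f'_def vanish)
  next
    case False
    then have "q z y \<noteq> 0" using zU[OF that] by (intro q0) auto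
    have "((\<lambda>z. q z y) has_field_derivative q' z y) (at z within U)"
      unfolding q_def q'_def by (auto intro!: derivative_eq_intros)
    from DERIV_power[OF this, of n]
    have "((\<lambda>z. q z y ^ n) has_field_derivative of_nat n * (q' z y * q z y ^ (n - 1))) (at z within U)"
      by simp
    moreover have "((\<lambda>z. of_real (A y) + z * of_real (B y)) has_field_derivative of_real (B y)) (at z within U)"
      by (auto intro!: derivative_eq_intros)
    ultimately show ?thesis
      unfolding f_def f'_def using \<open>q z y \<noteq> 0\<close> by (intro DERIV_divide) auto
  qed
  have contAB: "continuous_on S (\<lambda>zy. A (snd zy))" "continuous_on S (\<lambda>zy. B (snd zy))"
    for S :: "(complex \<times> 'a) set"
    by (rule continuous_on_compose2[OF cont(1)] continuous_on_compose2[OF cont(2)];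
        auto intro!: continuous_intros)+
  \<comment> \<open>The integrands are zero on one of two open sets that cover the domain and have nonzero
      denominator on the other one.\<close>
  have joint: "continuous_on (U \<times> UNIV) (\<lambda>(z, y). F z y)"
    if F0: "\<And>z y. norm (y - v) < r \<Longrightarrow> F z y = 0"
      and F1: "continuous_on {(z, y). q z y \<noteq> 0} (\<lambda>(z, y). F z y)" for F :: "complex \<Rightarrow> 'a \<Rightarrow> complex"
  proof -
    let ?S = "{zy :: complex \<times> 'a. norm (snd zy - v) < r}"
    let ?T = "{zy :: complex \<times> 'a. norm (fst zy) * norm h < norm (snd zy - v)}"
    have "continuous_on (?S \<union> ?T) (\<lambda>(z, y). F z y)"
    proof (rule continuous_on_open_Un)
      show "open ?S" "open ?T" by (intro open_Collect_less continuous_intros)+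
      show "continuous_on ?S (\<lambda>(z, y). F z y)"
        by (rule continuous_on_eq[of _ "\<lambda>_. 0"]) (auto simp: F0)
      show "continuous_on ?T (\<lambda>(z, y). F z y)"
        by (rule continuous_on_subset[OF F1]) (use q0 in auto)
    qed
    moreover have "U \<times> UNIV \<subseteq> ?S \<union> ?T" using zU by force
    ultimately show ?thesis by (rule continuous_on_subset)
  qed
  have contf: "continuous_on (U \<times> UNIV) (\<lambda>(z, y). f z y)"
  proof (rule joint)
    show "continuous_on {(z, y). q z y \<noteq> 0} (\<lambda>(z, y). f z y)"
      unfolding f_def q_def split_beta by (intro continuous_intros contAB) auto
  qed (simp add: f_def vanish)
  have contf': "continuous_on (U \<times> UNIV) (\<lambda>(z, y). f' z y)"
  proof (rule joint)
    show "continuous_on {(z, y). q z y \<noteq> 0} (\<lambda>(z, y). f' z y)"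
      unfolding f'_def q_def q'_def split_beta by (intro continuous_intros contAB) auto
  qed (simp add: f'_def vanish)
  define G where "G z = integral (cbox a b) (f z)" for z
  have hol: "G holomorphic_on U"
    unfolding G_def
  proof (rule leibniz_rule_holomorphic[OF deriv])
    show "f z integrable_on cbox a b" if "z \<in> U" for z
    proof (rule integrable_continuous)
      have "continuous_on (cbox a b) (\<lambda>y. (\<lambda>(z, y). f z y) (z, y))"
        by (rule continuous_on_compose2[OF contf]) (auto intro!: continuous_intros that)
      then show "continuous_on (cbox a b) (f z)" by simp
    qed
    show "continuous_on (U \<times> cbox a b) (\<lambda>(z, y). f' z y)"
      by (rule continuous_on_subset[OF contf']) auto
  qed (auto simp: U_def)
  have real: "G (of_real t) = of_real (integral (cbox a b)
      (\<lambda>y. (A y + t * B y) / ((norm (y - (v + t *\<^sub>R h)))\<^sup>2) ^ n))" if "of_real t \<in> U" for t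
  proof -
    have n: "(norm (y - (v + t *\<^sub>R h)))\<^sup>2 = (norm (y - v))\<^sup>2 - 2 * t * (h \<bullet> (y - v)) + t\<^sup>2 * (norm h)\<^sup>2" for y
      unfolding power2_norm_eq_inner
      by (simp add: inner_diff_left inner_diff_right inner_add_left inner_add_right inner_commute
          power2_eq_square algebra_simps)
    have eq: "f (of_real t) y = of_real ((A y + t * B y) / ((norm (y - (v + t *\<^sub>R h)))\<^sup>2) ^ n)" for y
      unfolding f_def n q_def by simp
    have "continuous_on (cbox a b) (\<lambda>y. (\<lambda>(z, y). f z y) (of_real t, y))"
      by (rule continuous_on_compose2[OF contf]) (auto intro!: continuous_intros that)
    then have "continuous_on (cbox a b) (\<lambda>y. Re (f (of_real t) y))" by (intro continuous_intros) simp
    then have "(\<lambda>y. (A y + t * B y) / ((norm (y - (v + t *\<^sub>R h)))\<^sup>2) ^ n) integrable_on cbox a b"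
      unfolding eq by (intro integrable_continuous) simp
    from has_integral_of_real[OF integrable_integral[OF this]] show ?thesis
      unfolding G_def eq by (rule integral_unique)
  qed
  have "G 1 = 0"
  proof (rule analytic_continuation[OF hol, where U = "of_real ` {0<..<min \<delta> 1}" and \<xi> = 0])
    show "0 islimpt (of_real ` {0<..<min \<delta> 1} :: complex set)"
      unfolding islimpt_approachable
    proof (intro allI impI)
      fix e :: real assume "e > 0"
      define t where "t = min (e / 2) (min \<delta> 1 / 2)"
      have "t > 0" "t < e" "t < min \<delta> 1" using \<open>e > 0\<close> \<open>\<delta> > 0\<close> by (auto simp: t_def min_def)
      then show "\<exists>x\<in>of_real ` {0<..<min \<delta> 1}. x \<noteq> (0::complex) \<and> dist x 0 < e"
        by (intro bexI[of _ "of_real t"]) auto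
    qed
    fix z :: complex assume "z \<in> of_real ` {0<..<min \<delta> 1}"
    then obtain t where t: "z = of_real t" "0 < t" "t < \<delta>" "t < 1" by auto
    then have "of_real t \<in> U" using \<rho>1 by (auto simp: U_def)
    then show "G z = 0" using real zero t by simp
  qed (use \<rho>1 in \<open>auto simp: U_def\<close>)
  then show ?thesis using real[of 1] \<rho>1 by (auto simp: U_def)
qed

text \<open>
  In dimension 8 the mass of \<open>\<epsilon> / ((norm (y - x))\<^sup>2 + \<epsilon>) ^ 5\<close> on the cube of half side
  \<open>sqrt \<epsilon>\<close> about \<open>x\<close> is bounded below independently of \<open>\<epsilon>\<close>, while away from \<open>x\<close> the kernel is
  of order \<open>\<epsilon>\<close>. If \<open>s x\<close> were positive, the integrals would stay above a positive constant.
\<close>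

lemma peaked_kernel_limit_nonpos:
  fixes s :: "'a::euclidean_space \<Rightarrow> real"
  assumes dim: "DIM('a) = 8" and cont: "continuous_on UNIV s" and x: "x \<in> box a b"
    and lim: "((\<lambda>\<epsilon>. integral (cbox a b) (\<lambda>y. \<epsilon> / ((norm (y - x))\<^sup>2 + \<epsilon>) ^ 5 * s y)) \<longlongrightarrow> 0) (at_right 0)"
  shows "s x \<le> 0"
proof (rule ccontr)
  assume "\<not> s x \<le> 0"
  define m where "m = s x / 2"
  have "m > 0" "m < s x" using \<open>\<not> s x \<le> 0\<close> by (auto simp: m_def)
  have "open (box a b \<inter> {y. m < s y})"
    by (intro open_Int open_box open_Collect_less continuous_intros cont)
  then obtain \<delta> where \<delta>: "\<delta> > 0" "ball x \<delta> \<subseteq> box a b \<inter> {y. m < s y}"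
    using x \<open>m < s x\<close> open_contains_ball by (metis IntI mem_Collect_eq)
  have "bounded (s ` cbox a b)"
    by (intro compact_imp_bounded compact_continuous_image compact_cbox continuous_on_subset[OF cont]) auto
  then obtain M where M: "\<And>y. y \<in> cbox a b \<Longrightarrow> \<bar>s y\<bar> \<le> M"
    by (auto simp: bounded_iff)
  define P where "P \<epsilon> y = \<epsilon> / ((norm (y - x))\<^sup>2 + \<epsilon>) ^ 5" for \<epsilon> y
  define C where "C = measure lborel (cbox a b)"
  define c0 where "c0 = 2 ^ 8 * m / 9 ^ 5"
  have lower: "integral (cbox a b) (\<lambda>y. P \<epsilon> y * s y) \<ge> c0 - \<epsilon> * (M / (\<delta>\<^sup>2) ^ 5 * C)"
    if \<epsilon>: "\<epsilon> > 0" "8 * \<epsilon> < \<delta>\<^sup>2" for \<epsilon>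
  proof -
    define Q where "Q = cbox (x - sqrt \<epsilon> *\<^sub>R One) (x + sqrt \<epsilon> *\<^sub>R (One::'a))"
    have Qn: "(norm (y - x))\<^sup>2 \<le> 8 * \<epsilon>" if "y \<in> Q" for y
    proof -
      have b: "((y - x) \<bullet> i)\<^sup>2 \<le> \<epsilon>" if "i \<in> Basis" for i
      proof -
        have "\<bar>(y - x) \<bullet> i\<bar> \<le> sqrt \<epsilon>"
          using \<open>y \<in> Q\<close> that by (auto simp: Q_def mem_box inner_diff_left inner_add_left)
        then have "\<bar>(y - x) \<bullet> i\<bar>\<^sup>2 \<le> (sqrt \<epsilon>)\<^sup>2" by (intro power_mono) auto
        then show ?thesis using \<epsilon> by simp
      qed
      have "(norm (y - x))\<^sup>2 = (\<Sum>i\<in>Basis. ((y - x) \<bullet> i)\<^sup>2)"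
        unfolding power2_norm_eq_inner by (subst euclidean_inner) (simp add: power2_eq_square)
      also have "\<dots> \<le> (\<Sum>i\<in>(Basis::'a set). \<epsilon>)" by (intro sum_mono b)
      also have "\<dots> = 8 * \<epsilon>" using dim by simp
      finally show ?thesis .
    qed
    have Qball: "Q \<subseteq> ball x \<delta>"
    proof
      fix y assume "y \<in> Q"
      then have "(norm (y - x))\<^sup>2 < \<delta>\<^sup>2" using Qn \<epsilon> by force
      then have "norm (y - x) < \<delta>" using \<delta>(1) power_less_imp_less_base[of _ 2 \<delta>] by auto
      then show "y \<in> ball x \<delta>" by (simp add: dist_norm norm_minus_commute)
    qed
    then have Qab: "Q \<subseteq> cbox a b" using \<delta>(2) box_subset_cbox by blast
    have P0: "P \<epsilon> y \<ge> 0" for y using \<epsilon> by (simp add: P_def)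
    \<comment> \<open>Inside the ball of radius \<open>\<delta>\<close> the integrand is nonnegative, and on \<open>Q\<close> it is large; outside
        the ball it is at least the negative term.\<close>
    have pw: "(if y \<in> Q then m * (\<epsilon> / (9 * \<epsilon>) ^ 5) else 0) - \<epsilon> * M / (\<delta>\<^sup>2) ^ 5 \<le> P \<epsilon> y * s y"
      if y: "y \<in> cbox a b" for y
    proof -
      have "M \<ge> 0" using M[OF y] by linarith
      then have nn: "0 \<le> \<epsilon> * M / (\<delta>\<^sup>2) ^ 5" using \<epsilon> by simp
      show ?thesis
      proof (cases "norm (y - x) < \<delta>")
        case True
        then have "y \<in> ball x \<delta>" by (simp add: dist_norm norm_minus_commute)
        then have sm: "m < s y" using \<delta>(2) by auto
        have "m * (\<epsilon> / (9 * \<epsilon>) ^ 5) \<le> s y * P \<epsilon> y" if "y \<in> Q"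
        proof (rule mult_mono)
          have "(norm (y - x))\<^sup>2 + \<epsilon> \<le> 9 * \<epsilon>" using Qn[OF that] by simp
          then show "\<epsilon> / (9 * \<epsilon>) ^ 5 \<le> P \<epsilon> y"
            unfolding P_def using \<epsilon>
            by (intro divide_left_mono power_mono mult_pos_pos zero_less_power)
              (auto intro: add_nonneg_pos)
        qed (use sm \<open>m > 0\<close> \<epsilon> in auto)
        moreover have "0 \<le> s y * P \<epsilon> y" using sm \<open>m > 0\<close> P0[of y] by simp
        ultimately show ?thesis using nn by (auto simp: mult.commute)
      next
        case False
        then have "y \<notin> Q" using Qball by (auto simp: dist_norm norm_minus_commute)
        have "\<delta>\<^sup>2 \<le> (norm (y - x))\<^sup>2 + \<epsilon>"
        proof -
          have "\<delta>\<^sup>2 \<le> (norm (y - x))\<^sup>2" using False \<delta>(1) by (intro power_mono) auto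
          then show ?thesis using \<epsilon> by simp
        qed
        then have "P \<epsilon> y \<le> \<epsilon> / (\<delta>\<^sup>2) ^ 5"
          unfolding P_def using \<epsilon> \<delta>(1)
          by (intro divide_left_mono power_mono mult_pos_pos zero_less_power)
            (auto intro: add_nonneg_pos)
        then have "P \<epsilon> y * \<bar>s y\<bar> \<le> \<epsilon> / (\<delta>\<^sup>2) ^ 5 * M"
          using M[OF y] P0 \<epsilon> by (intro mult_mono) auto
        moreover have "- (P \<epsilon> y * \<bar>s y\<bar>) \<le> P \<epsilon> y * s y"
          using mult_left_mono[of "- \<bar>s y\<bar>" "s y" "P \<epsilon> y"] P0[of y] by simp
        ultimately show ?thesis using \<open>y \<notin> Q\<close> by (simp add: field_simps)
      qed
    qed
    have contQ: "measure lborel Q = 2 ^ 8 * \<epsilon> ^ 4"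
    proof -
      have "measure lborel Q = (\<Prod>i\<in>(Basis::'a set). 2 * sqrt \<epsilon>)"
        unfolding Q_def using \<epsilon> by (subst content_cbox) (auto simp: inner_diff_left inner_add_left)
      also have "\<dots> = 2 ^ 8 * ((sqrt \<epsilon>)\<^sup>2) ^ 4"
        using dim by (simp add: power_mult_distrib flip: power_mult)
      finally show ?thesis using \<epsilon> by simp
    qed
    have "((\<lambda>y. if y \<in> Q then m * (\<epsilon> / (9 * \<epsilon>) ^ 5) else 0) has_integral
        measure lborel Q *\<^sub>R (m * (\<epsilon> / (9 * \<epsilon>) ^ 5))) (cbox a b)"
      unfolding has_integral_restrict[OF Qab] unfolding Q_def by (rule has_integral_const)
    note I = has_integral_diff[OF this has_integral_const[of "\<epsilon> * M / (\<delta>\<^sup>2) ^ 5" a b]]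
    have L: "((\<lambda>y. (if y \<in> Q then m * (\<epsilon> / (9 * \<epsilon>) ^ 5) else 0) - \<epsilon> * M / (\<delta>\<^sup>2) ^ 5) has_integral
        (c0 - \<epsilon> * (M / (\<delta>\<^sup>2) ^ 5 * C))) (cbox a b)"
    proof -
      have 1: "measure lborel Q *\<^sub>R (m * (\<epsilon> / (9 * \<epsilon>) ^ 5)) = c0"
        using \<epsilon> by (simp add: contQ c0_def eval_nat_numeral)
      have 2: "measure lborel (cbox a b) *\<^sub>R (\<epsilon> * M / (\<delta>\<^sup>2) ^ 5) = \<epsilon> * (M / (\<delta>\<^sup>2) ^ 5 * C)"
        by (simp add: C_def)
      show ?thesis using I unfolding 1 2 .
    qed
    have "continuous_on (cbox a b) (\<lambda>y. P \<epsilon> y * s y)"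
    proof -
      have "(norm (y - x))\<^sup>2 + \<epsilon> \<noteq> 0" for y using \<epsilon> by (smt (verit) zero_le_power2)
      then show ?thesis
        unfolding P_def by (intro continuous_intros continuous_on_subset[OF cont]) auto
    qed
    then have "(\<lambda>y. P \<epsilon> y * s y) integrable_on cbox a b" by (rule integrable_continuous)
    from has_integral_le[OF L integrable_integral[OF this] pw] show ?thesis .
  qed
  have "((\<lambda>\<epsilon>. c0 - \<epsilon> * (M / (\<delta>\<^sup>2) ^ 5 * C)) \<longlongrightarrow> c0) (at_right 0)"
    using \<delta>(1) by (auto intro!: tendsto_eq_intros)
  moreover have "\<forall>\<^sub>F \<epsilon> in at_right 0. c0 - \<epsilon> * (M / (\<delta>\<^sup>2) ^ 5 * C) \<le> integral (cbox a b) (\<lambda>y. P \<epsilon> y * s y)"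
    unfolding eventually_at_right_field
    using lower \<delta>(1) by (intro exI[of _ "\<delta>\<^sup>2 / 8"]) auto
  ultimately have "c0 \<le> 0"
    using tendsto_le[OF _ lim[folded P_def]] by simp
  then show False using \<open>m > 0\<close> by (simp add: c0_def)
qed

section \<open>Unique continuation for monogenic functions of eight variables\<close>

lemma bounded_linear_oct_conj: "bounded_linear oct_conj"
  using linear_oct_conj linear_conv_bounded_linear by blast

text \<open>
  With \<open>w = y - x\<close> and \<open>N = (norm w)\<^sup>2 + \<epsilon>\<close> the integrand is
  \<open>\<Sum>b\<in>Basis. \<partial>\<^sub>b (N powi (-4) *\<^sub>R (oct_conj w \<odot> (b \<odot> \<psi> y)))\<close>: the derivatives of \<open>\<psi>\<close> produce the
  second summand, those of \<open>oct_conj w\<close> produce \<open>8 / N ^ 4\<close>, and those of \<open>N\<close> produce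
  \<open>- 8 * (norm w)\<^sup>2 / N ^ 5\<close>, which leaves \<open>8 * \<epsilon> / N ^ 5\<close>. The last two use \<open>oct_conj_mult_cancel\<close>
  in place of associativity. As \<open>\<epsilon>\<close> tends to 0 this becomes the Cauchy-Pompeiu formula.
\<close>

lemma regularized_Cauchy_identity:
  fixes \<psi> :: "oct \<Rightarrow> oct" and \<psi>' :: "oct \<Rightarrow> oct \<Rightarrow> oct"
  assumes deriv: "\<And>y b. b \<in> Basis \<Longrightarrow> ((\<lambda>t. \<psi> (y + t *\<^sub>R b)) has_vector_derivative \<psi>' b y) (at 0)"
    and cont: "continuous_on UNIV \<psi>" "\<And>b. b \<in> Basis \<Longrightarrow> continuous_on UNIV (\<psi>' b)"
    and supp: "\<And>y. y \<notin> cbox l u \<Longrightarrow> \<psi> y = 0" and \<epsilon>: "\<epsilon> > 0"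
  shows "integral (cbox l u) (\<lambda>y. (8 * \<epsilon> / ((norm (y - x))\<^sup>2 + \<epsilon>) ^ 5) *\<^sub>R \<psi> y
      + (1 / ((norm (y - x))\<^sup>2 + \<epsilon>) ^ 4) *\<^sub>R (oct_conj (y - x) \<odot> (\<Sum>b\<in>Basis. b \<odot> \<psi>' b y))) = 0"
proof -
  define N where "N y = (norm (y - x))\<^sup>2 + \<epsilon>" for y
  have N0: "N y > 0" for y unfolding N_def using \<epsilon> by (intro add_nonneg_pos) auto
  then have N1: "N y \<noteq> 0" for y using less_imp_neq by metis
  have contN: "continuous_on UNIV N" unfolding N_def by (intro continuous_intros)
  have contconj: "continuous_on UNIV (\<lambda>y. oct_conj (y - x))"
    by (intro bounded_linear.continuous_on[OF bounded_linear_oct_conj] continuous_intros)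
  define T where "T b y = (1 / N y ^ 4) *\<^sub>R (oct_conj (y - x) \<odot> (b \<odot> \<psi> y))" for b y
  define T' where "T' b y = (1 / N y ^ 4) *\<^sub>R (oct_conj (y - x) \<odot> (b \<odot> \<psi>' b y) + oct_conj b \<odot> (b \<odot> \<psi> y))
      + (- (8 * ((y - x) \<bullet> b) / N y ^ 5)) *\<^sub>R (oct_conj (y - x) \<odot> (b \<odot> \<psi> y))" for b y
  have contT': "continuous_on UNIV (T' b)" if "b \<in> Basis" for b
    unfolding T'_def using N1
    by (intro continuous_intros oct.continuous_on contconj contN cont that) auto
  have "integral (cbox l u) (T' b) = 0" if b: "b \<in> Basis" for b
  proof (rule integral_directional_derivative_zero[where e = b])
    fix y
    have N: "((\<lambda>t. N (y + t *\<^sub>R b)) has_real_derivative 2 * ((y - x) \<bullet> b)) (at 0)"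
    proof -
      have "N (y + t *\<^sub>R b) = (norm (y - x))\<^sup>2 + 2 * t * ((y - x) \<bullet> b) + t\<^sup>2 * (b \<bullet> b) + \<epsilon>" for t
        unfolding N_def power2_norm_eq_inner
        by (simp add: inner_diff_left inner_diff_right inner_add_left inner_add_right inner_commute
            power2_eq_square algebra_simps)
      then show ?thesis by (auto intro!: derivative_eq_intros)
    qed
    have "((\<lambda>t. 1 / N (y + t *\<^sub>R b) ^ 4) has_real_derivative - (8 * ((y - x) \<bullet> b) / N y ^ 5)) (at 0)"
    proof -
      have "((\<lambda>t. 1 / N (y + t *\<^sub>R b) ^ 4) has_real_derivative
          (0 * N (y + 0 *\<^sub>R b) ^ 4 - 1 * (4 * (2 * ((y - x) \<bullet> b) * N (y + 0 *\<^sub>R b) ^ 3)))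
          / (N (y + 0 *\<^sub>R b) ^ 4 * N (y + 0 *\<^sub>R b) ^ 4)) (at 0)"
        using DERIV_divide[OF DERIV_const[of 1] DERIV_power[OF N, of 4]] N1 by simp
      also have "(0 * N (y + 0 *\<^sub>R b) ^ 4 - 1 * (4 * (2 * ((y - x) \<bullet> b) * N (y + 0 *\<^sub>R b) ^ 3)))
          / (N (y + 0 *\<^sub>R b) ^ 4 * N (y + 0 *\<^sub>R b) ^ 4) = - (8 * ((y - x) \<bullet> b) / N y ^ 5)"
        using N1[of y] by (simp add: eval_nat_numeral)
      finally show ?thesis .
    qed
    note 1 = this
    have "((\<lambda>t. oct_conj (y + t *\<^sub>R b - x)) has_vector_derivative oct_conj b) (at 0)"
    proof -
      have "oct_conj (y + t *\<^sub>R b - x) = oct_conj (y - x) + t *\<^sub>R oct_conj b" for t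
        by (simp add: linear_add[OF linear_oct_conj] linear_diff[OF linear_oct_conj]
            linear_scale[OF linear_oct_conj] algebra_simps)
      then show ?thesis by (auto intro!: derivative_eq_intros)
    qed
    note 2 = this
    have "((\<lambda>t. b \<odot> \<psi> (y + t *\<^sub>R b)) has_vector_derivative b \<odot> \<psi>' b y) (at 0)"
      using oct.has_vector_derivative[OF has_vector_derivative_const deriv[OF b]]
      by (simp add: oct.zero_left)
    from has_vector_derivative_scaleR[OF 1 oct.has_vector_derivative[OF 2 this]]
    show "((\<lambda>t. T b (y + t *\<^sub>R b)) has_vector_derivative T' b y) (at 0)"
      unfolding T_def T'_def by simp
  next
    show "continuous_on UNIV (T b)"
      unfolding T_def using N1
      by (intro continuous_intros oct.continuous_on contconj contN cont) auto
    show "continuous_on UNIV (T' b)" by (rule contT'[OF b])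
    show "T b y = 0" if "y \<notin> cbox l u" for y
      using supp[OF that] by (simp add: T_def oct.zero_right)
  qed
  then have "integral (cbox l u) (\<lambda>y. \<Sum>b\<in>Basis. T' b y) = 0"
    by (subst integral_sum) (auto intro!: integrable_continuous continuous_on_subset[OF contT'])
  moreover have "(\<Sum>b\<in>Basis. T' b y) = (8 * \<epsilon> / N y ^ 5) *\<^sub>R \<psi> y
      + (1 / N y ^ 4) *\<^sub>R (oct_conj (y - x) \<odot> (\<Sum>b\<in>Basis. b \<odot> \<psi>' b y))" for y
  proof -
    have 1: "(\<Sum>b\<in>Basis. oct_conj b \<odot> (b \<odot> \<psi> y)) = 8 *\<^sub>R \<psi> y"
      by (simp add: oct_conj_mult_cancel sum_constant_scaleR del: sum_constant)
    have "(\<Sum>b\<in>Basis. ((y - x) \<bullet> b) *\<^sub>R (oct_conj (y - x) \<odot> (b \<odot> \<psi> y)))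
        = oct_conj (y - x) \<odot> ((\<Sum>b\<in>Basis. ((y - x) \<bullet> b) *\<^sub>R b) \<odot> \<psi> y)"
      by (simp only: oct.sum_left oct.sum_right oct.scaleR_left oct.scaleR_right)
    also have "\<dots> = (norm (y - x))\<^sup>2 *\<^sub>R \<psi> y"
      by (simp only: euclidean_representation oct_conj_mult_cancel power2_norm_eq_inner)
    finally have 2: "(\<Sum>b\<in>Basis. ((y - x) \<bullet> b) *\<^sub>R (oct_conj (y - x) \<odot> (b \<odot> \<psi> y)))
        = (norm (y - x))\<^sup>2 *\<^sub>R \<psi> y" .
    have 2: "(\<Sum>b\<in>Basis. (- (8 * ((y - x) \<bullet> b) / N y ^ 5)) *\<^sub>R (oct_conj (y - x) \<odot> (b \<odot> \<psi> y)))
        = (- 8 / N y ^ 5) *\<^sub>R (norm (y - x))\<^sup>2 *\<^sub>R \<psi> y"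
    proof -
      have "(- (8 * ((y - x) \<bullet> b) / N y ^ 5)) *\<^sub>R a = (- 8 / N y ^ 5) *\<^sub>R ((y - x) \<bullet> b) *\<^sub>R a"
        for a b :: oct by simp
      with 2 show ?thesis by (simp only: scaleR_sum_right[symmetric])
    qed
    have 3: "8 / N y ^ 4 - 8 * (norm (y - x))\<^sup>2 / N y ^ 5 = 8 * \<epsilon> / N y ^ 5"
    proof -
      have "8 / N y ^ 4 = 8 * N y / N y ^ 5" using N1[of y] by (simp add: eval_nat_numeral)
      then have "8 / N y ^ 4 - 8 * (norm (y - x))\<^sup>2 / N y ^ 5 = (8 * N y - 8 * (norm (y - x))\<^sup>2) / N y ^ 5"
        by (simp add: diff_divide_distrib)
      also have "8 * N y - 8 * (norm (y - x))\<^sup>2 = 8 * \<epsilon>" by (simp add: N_def)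
      finally show ?thesis .
    qed
    have "(\<Sum>b\<in>Basis. T' b y) = (1 / N y ^ 4) *\<^sub>R (oct_conj (y - x) \<odot> (\<Sum>b\<in>Basis. b \<odot> \<psi>' b y))
        + (1 / N y ^ 4) *\<^sub>R 8 *\<^sub>R \<psi> y + (- 8 / N y ^ 5) *\<^sub>R (norm (y - x))\<^sup>2 *\<^sub>R \<psi> y"
      unfolding T'_def sum.distrib scaleR_add_right 2
      by (simp only: 1[symmetric] oct.sum_right scaleR_sum_right)
    also have "\<dots> = (8 / N y ^ 4 - 8 * (norm (y - x))\<^sup>2 / N y ^ 5) *\<^sub>R \<psi> y
        + (1 / N y ^ 4) *\<^sub>R (oct_conj (y - x) \<odot> (\<Sum>b\<in>Basis. b \<odot> \<psi>' b y))"
      by (simp add: algebra_simps)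
    finally show ?thesis unfolding 3 .
  qed
  ultimately show ?thesis by (simp add: N_def)
qed

text \<open>
  Let \<open>\<psi>\<close> be \<open>U\<close> times a cutoff that is 1 on a ball of radius \<open>r\<close> about the centre, with \<open>x\<close>
  inside. The Dirac derivative \<open>H\<close> of \<open>\<psi>\<close> is zero on this ball, where \<open>\<psi> = U\<close>. By the
  regularized Cauchy identity the averages \<open>\<Phi> z \<epsilon>\<close> of \<open>\<psi>\<close> peaked at \<open>z\<close> equal the kernel
  integrals \<open>- J z \<epsilon>\<close> of \<open>H\<close>. For \<open>z\<close> near the centre the averages tend to 0 with \<open>\<epsilon>\<close>, since \<open>\<psi>\<close>
  vanishes there. So \<open>J z 0\<close> is zero near the centre, by analyticity also for \<open>z = x\<close>, and the
  averages peaked at \<open>x\<close> tend to 0 as well.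
\<close>

lemma monogenic_zero_near_center_imp_zero_on_ball:
  fixes U :: "oct \<Rightarrow> oct" and U' :: "oct \<Rightarrow> oct \<Rightarrow> oct"
  assumes W: "open W" "cball v R \<subseteq> W"
    and deriv: "\<And>y b. y \<in> W \<Longrightarrow> b \<in> Basis \<Longrightarrow> ((\<lambda>t. U (y + t *\<^sub>R b)) has_vector_derivative U' b y) (at 0)"
    and cont: "\<And>b. b \<in> Basis \<Longrightarrow> continuous_on W (U' b)"
    and dirac: "\<And>y. y \<in> W \<Longrightarrow> (\<Sum>b\<in>Basis. b \<odot> U' b y) = 0"
    and \<delta>: "\<delta> > 0" "\<And>y. y \<in> ball v \<delta> \<Longrightarrow> U y = 0"
    and x: "x \<in> ball v R"
  shows "U x = 0"
proof -
  define r where "r = (norm (x - v) + R) / 2"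
  have "norm (x - v) < R" using x by (simp add: dist_norm norm_minus_commute)
  then have xr: "norm (x - v) < r" "r < R" by (simp_all add: r_def)
  then have "r > 0" using norm_ge_zero[of "x - v"] by linarith
  note xr = xr this
  have contU: "continuous_on W U"
    by (rule continuous_on_of_continuous_partials[OF W(1) deriv cont])
  have "r\<^sup>2 < R\<^sup>2" using xr by (intro power_strict_mono) auto
  then obtain \<kappa> \<kappa>' where \<kappa>: "\<And>s. (\<kappa> has_real_derivative \<kappa>' s) (at s)" "continuous_on UNIV \<kappa>'"
    "\<And>s. s \<le> r\<^sup>2 \<Longrightarrow> \<kappa> s = 1" "\<And>s. s \<le> r\<^sup>2 \<Longrightarrow> \<kappa>' s = 0"
    "\<And>s. s \<ge> R\<^sup>2 \<Longrightarrow> \<kappa> s = 0" "\<And>s. s \<ge> R\<^sup>2 \<Longrightarrow> \<kappa>' s = 0"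
    using C1_cutoff by blast
  have cont\<kappa>: "continuous_on UNIV \<kappa>" by (rule DERIV_continuous_on[OF \<kappa>(1)])
  define \<psi> where "\<psi> y = \<kappa> ((norm (y - v))\<^sup>2) *\<^sub>R U y" for y
  define \<psi>' where "\<psi>' b y = \<kappa> ((norm (y - v))\<^sup>2) *\<^sub>R U' b y
      + (\<kappa>' ((norm (y - v))\<^sup>2) * (2 * ((y - v) \<bullet> b))) *\<^sub>R U y" for b y
  define H where "H y = (\<Sum>b\<in>Basis. b \<odot> \<psi>' b y)" for y
  have outside: "(norm (y - v))\<^sup>2 \<ge> R\<^sup>2" if "y \<notin> ball v R" for y
    using that xr by (intro power_mono) (auto simp: dist_norm norm_minus_commute)
  have cover: "UNIV = W \<union> - cball v R" using W by auto
  have contn: "continuous_on S (\<lambda>y. \<kappa> ((norm (y - v))\<^sup>2))" "continuous_on S (\<lambda>y. \<kappa>' ((norm (y - v))\<^sup>2))" for S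
    by (rule continuous_on_compose2[OF cont\<kappa>] continuous_on_compose2[OF \<kappa>(2)];
        auto intro!: continuous_intros)+
  have glue: "continuous_on UNIV F"
    if "continuous_on W F" "\<And>y. y \<in> - cball v R \<Longrightarrow> F y = 0" for F :: "oct \<Rightarrow> oct"
    unfolding cover
  proof (rule continuous_on_open_Un)
    show "continuous_on (- cball v R) F"
      by (rule continuous_on_eq[of _ "\<lambda>_. 0"]) (simp_all add: that)
  qed (use W that in auto)
  have cont\<psi>: "continuous_on UNIV \<psi>"
  proof (rule glue)
    show "continuous_on W \<psi>" unfolding \<psi>_def by (intro continuous_intros contn contU)
  qed (use outside \<kappa> in \<open>auto simp: \<psi>_def\<close>)
  have cont\<psi>': "continuous_on UNIV (\<psi>' b)" if "b \<in> Basis" for b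
  proof (rule glue)
    show "continuous_on W (\<psi>' b)" unfolding \<psi>'_def by (intro continuous_intros contn contU cont that)
  qed (use outside \<kappa> in \<open>auto simp: \<psi>'_def\<close>)
  have deriv\<psi>: "((\<lambda>t. \<psi> (y + t *\<^sub>R b)) has_vector_derivative \<psi>' b y) (at 0)" if b: "b \<in> Basis" for y b
  proof (cases "y \<in> W")
    case True
    have "(norm (y + t *\<^sub>R b - v))\<^sup>2 = (norm (y - v))\<^sup>2 + 2 * t * ((y - v) \<bullet> b) + t\<^sup>2 * (b \<bullet> b)" for t
      unfolding power2_norm_eq_inner
      by (simp add: inner_diff_left inner_diff_right inner_add_left inner_add_right inner_commute
          power2_eq_square algebra_simps)
    then have "((\<lambda>t. (norm (y + t *\<^sub>R b - v))\<^sup>2) has_real_derivative 2 * ((y - v) \<bullet> b)) (at 0)"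
      by (auto intro!: derivative_eq_intros)
    from DERIV_chain2[OF \<kappa>(1) this]
    have "((\<lambda>t. \<kappa> ((norm (y + t *\<^sub>R b - v))\<^sup>2)) has_real_derivative
        \<kappa>' ((norm (y - v))\<^sup>2) * (2 * ((y - v) \<bullet> b))) (at 0)" by simp
    from has_vector_derivative_scaleR[OF this deriv[OF True b]] show ?thesis
      unfolding \<psi>_def \<psi>'_def by simp
  next
    case False
    then have y: "y \<in> - cball v R" using W by auto
    have "open ((\<lambda>t. y + t *\<^sub>R b) -` (- cball v R))"
      by (intro open_vimage continuous_intros open_Compl closed_cball)
    moreover have "\<psi> z = 0" if "z \<in> - cball v R" for z
      using outside[of z] that \<kappa> by (simp add: \<psi>_def)
    ultimately have "((\<lambda>t. \<psi> (y + t *\<^sub>R b)) has_vector_derivative 0) (at 0)"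
      using y by - (rule has_vector_derivative_transform_within_open[where f="\<lambda>_. 0"
            and S="(\<lambda>t. y + t *\<^sub>R b) -` (- cball v R)"], auto)
    moreover have "\<psi>' b y = 0" using outside[of y] y \<kappa> by (simp add: \<psi>'_def)
    ultimately show ?thesis by simp
  qed
  have H: "H y = (2 * \<kappa>' ((norm (y - v))\<^sup>2)) *\<^sub>R ((y - v) \<odot> U y)" for y
  proof (cases "y \<in> W")
    case True
    have "H y = \<kappa> ((norm (y - v))\<^sup>2) *\<^sub>R (\<Sum>b\<in>Basis. b \<odot> U' b y)
        + (2 * \<kappa>' ((norm (y - v))\<^sup>2)) *\<^sub>R (\<Sum>b\<in>Basis. ((y - v) \<bullet> b) *\<^sub>R (b \<odot> U y))"
      unfolding H_def \<psi>'_def oct.add_right oct.scaleR_right sum.distrib scaleR_sum_right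
      by (simp add: mult_ac)
    also have "(\<Sum>b\<in>Basis. ((y - v) \<bullet> b) *\<^sub>R (b \<odot> U y)) = (y - v) \<odot> U y"
      by (simp only: oct.scaleR_left[symmetric] oct.sum_left[symmetric] euclidean_representation)
    finally show ?thesis using dirac[OF True] by simp
  next
    case False
    then have "y \<notin> ball v R" using W ball_subset_cball[of v R] by blast
    then show ?thesis using \<kappa>(5,6)[OF outside] by (simp add: H_def \<psi>'_def oct.zero_right)
  qed
  have H0: "H y = 0" if "norm (y - v) < r" for y
  proof -
    have "(norm (y - v))\<^sup>2 \<le> r\<^sup>2" using that by (intro power_mono) auto
    then show ?thesis by (simp add: H \<kappa>)
  qed
  have contH: "continuous_on UNIV H"
    unfolding H_def by (intro continuous_intros oct.continuous_on cont\<psi>')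
  obtain c where c: "cball v R \<subseteq> box (- c) c"
    using bounded_subset_box_symmetric[OF bounded_cball] by metis
  have supp: "\<psi> y = 0" if "y \<notin> cbox (- c) c" for y
  proof -
    have "y \<notin> ball v R" using that c box_subset_cbox[of "-c" c] ball_subset_cball[of v R] by blast
    then show ?thesis using outside[of y] \<kappa> by (simp add: \<psi>_def)
  qed
  define K where "K z y = oct_conj (y - z) \<odot> H y" for z y
  have contK: "continuous_on UNIV (K z)" for z
    unfolding K_def
    by (intro oct.continuous_on bounded_linear.continuous_on[OF bounded_linear_oct_conj]
        continuous_intros contH)
  define \<Phi> where "\<Phi> z \<epsilon> = integral (cbox (- c) c) (\<lambda>y. (8 * \<epsilon> / ((norm (y - z))\<^sup>2 + \<epsilon>) ^ 5) *\<^sub>R \<psi> y)" for z \<epsilon>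
  define J where "J z \<epsilon> = integral (cbox (- c) c) (\<lambda>y. (1 / ((norm (y - z))\<^sup>2 + \<epsilon>) ^ 4) *\<^sub>R K z y)" for z \<epsilon>
  have \<Phi>J: "\<Phi> z \<epsilon> = - J z \<epsilon>" if "\<epsilon> > 0" for z \<epsilon>
  proof -
    have N: "(norm (y - z))\<^sup>2 + \<epsilon> \<noteq> 0" for y
      using that by (metis add_nonneg_pos less_irrefl zero_le_power2)
    have "(\<lambda>y. (8 * \<epsilon> / ((norm (y - z))\<^sup>2 + \<epsilon>) ^ 5) *\<^sub>R \<psi> y) integrable_on cbox (- c) c"
      "(\<lambda>y. (1 / ((norm (y - z))\<^sup>2 + \<epsilon>) ^ 4) *\<^sub>R K z y) integrable_on cbox (- c) c"
      using N by (intro integrable_continuous continuous_intros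
          continuous_on_subset[OF cont\<psi>] continuous_on_subset[OF contK] subset_UNIV; simp)+
    then have "\<Phi> z \<epsilon> + J z \<epsilon> = 0"
      unfolding \<Phi>_def J_def K_def H_def
      by (subst integral_add[symmetric])
        (use regularized_Cauchy_identity[OF deriv\<psi> cont\<psi> cont\<psi>' supp that] in simp_all)
    then show ?thesis by (simp add: eq_neg_iff_add_eq_0)
  qed
  have J_lim: "(J z \<longlongrightarrow> J z 0) (at_right 0)" if "norm (z - v) < r" for z
  proof -
    have "K z y = 0" if "norm (y - z) < r - norm (z - v)" for y
      using that norm_triangle_ineq[of "y - z" "z - v"] by (simp add: K_def H0 oct.zero_right)
    then have "continuous_on {0..} (J z)"
      unfolding J_def using that by (intro continuous_kernel_integral[OF contK, of "r - norm (z - v)"]) auto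
    then have "(J z \<longlongrightarrow> J z 0) (at 0 within {0..})" by (simp add: continuous_on_def)
    then show ?thesis by (rule tendsto_within_subset) auto
  qed
  have J_near: "J z 0 = 0" if "norm (z - v) < min \<delta> r" for z
  proof -
    have "\<psi> y = 0" if "norm (y - z) < \<delta> - norm (z - v)" for y
    proof -
      have "norm (y - v) < \<delta>" using that norm_triangle_ineq[of "y - z" "z - v"] by simp
      then show ?thesis using \<delta>(2)[of y] by (simp add: \<psi>_def dist_norm norm_minus_commute)
    qed
    then have "continuous_on {0..} (\<lambda>\<epsilon>. integral (cbox (- c) c) (\<lambda>y. (1 / ((norm (y - z))\<^sup>2 + \<epsilon>) ^ 5) *\<^sub>R \<psi> y))"
      using that by (intro continuous_kernel_integral[OF cont\<psi>, of "\<delta> - norm (z - v)"]) auto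
    then have "continuous_on {0..} (\<lambda>\<epsilon>. (8 * \<epsilon>) *\<^sub>R integral (cbox (- c) c) (\<lambda>y. (1 / ((norm (y - z))\<^sup>2 + \<epsilon>) ^ 5) *\<^sub>R \<psi> y))"
      by (intro continuous_intros)
    also have "(\<lambda>\<epsilon>. (8 * \<epsilon>) *\<^sub>R integral (cbox (- c) c) (\<lambda>y. (1 / ((norm (y - z))\<^sup>2 + \<epsilon>) ^ 5) *\<^sub>R \<psi> y)) = \<Phi> z"
      unfolding \<Phi>_def by (simp flip: integral_cmul)
    finally have "(\<Phi> z \<longlongrightarrow> \<Phi> z 0) (at 0 within {0..})" by (simp add: continuous_on_def)
    then have "(\<Phi> z \<longlongrightarrow> \<Phi> z 0) (at_right 0)" by (rule tendsto_within_subset) auto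
    then have "(\<Phi> z \<longlongrightarrow> 0) (at_right 0)" by (simp add: \<Phi>_def)
    moreover have "(\<Phi> z \<longlongrightarrow> - J z 0) (at_right 0)"
    proof (rule Lim_transform_eventually)
      show "((\<lambda>\<epsilon>. - J z \<epsilon>) \<longlongrightarrow> - J z 0) (at_right 0)"
        using that by (intro tendsto_minus J_lim) simp
      show "\<forall>\<^sub>F \<epsilon> in at_right 0. - J z \<epsilon> = \<Phi> z \<epsilon>"
        using \<Phi>J by (auto simp: eventually_at_right_field intro!: exI[of _ 1])
    qed
    ultimately show ?thesis using tendsto_unique[of "at_right (0::real)"] by fastforce
  qed
  have "J x 0 = 0"
  proof (rule euclidean_eqI)
    fix b :: oct assume b: "b \<in> Basis"
    define h where "h = x - v"
    define A where "A y = K v y \<bullet> b" for y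
    define B where "B y = - (oct_conj h \<odot> H y) \<bullet> b" for y
    have contA: "continuous_on UNIV A" "continuous_on UNIV B"
      unfolding A_def B_def by (intro continuous_intros contK oct.continuous_on contH)+
    have KAB: "K (v + t *\<^sub>R h) y \<bullet> b = A y + t * B y" for t y
    proof -
      have "oct_conj (y - (v + t *\<^sub>R h)) = oct_conj (y - v) - t *\<^sub>R oct_conj h"
        by (simp add: linear_add[OF linear_oct_conj] linear_diff[OF linear_oct_conj]
            linear_scale[OF linear_oct_conj] algebra_simps)
      then show ?thesis
        by (simp add: A_def B_def K_def oct.diff_left oct.scaleR_left inner_diff_left)
    qed
    \<comment> \<open>The kernel is singular at \<open>v + t *\<^sub>R h\<close>, but \<open>H\<close> vanishes near this point; integrability follows
        after bounding the distance from below.\<close>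
    have JAB: "J (v + t *\<^sub>R h) 0 \<bullet> b =
        integral (cbox (- c) c) (\<lambda>y. (A y + t * B y) / ((norm (y - (v + t *\<^sub>R h)))\<^sup>2) ^ 4)"
      if "norm (t *\<^sub>R h) < r" for t
    proof -
      let ?z = "v + t *\<^sub>R h"
      have "K ?z y = 0" if "norm (y - ?z) < r - norm (t *\<^sub>R h)" for y
        using that norm_triangle_ineq[of "y - ?z" "t *\<^sub>R h"] by (simp add: K_def H0 oct.zero_right)
      note K0 = this
      define d where "d = r - norm (t *\<^sub>R h)"
      have d: "d > 0" using that by (simp add: d_def)
      have eq: "(1 / ((norm (y - ?z))\<^sup>2 + 0) ^ 4) *\<^sub>R K ?z y
          = (1 / (max (d\<^sup>2) ((norm (y - ?z))\<^sup>2)) ^ 4) *\<^sub>R K ?z y" for y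
      proof (cases "norm (y - ?z) < d")
        case False
        then have "d\<^sup>2 \<le> (norm (y - ?z))\<^sup>2" using d by (intro power_mono) auto
        then show ?thesis by (simp add: max_def)
      qed (simp add: K0 d_def)
      have "(\<lambda>y. (1 / ((norm (y - ?z))\<^sup>2 + 0) ^ 4) *\<^sub>R K ?z y) integrable_on cbox (- c) c"
        unfolding eq
      proof (intro integrable_continuous continuous_intros continuous_on_subset[OF contK] subset_UNIV ballI)
        have "max (d\<^sup>2) ((norm (y - ?z))\<^sup>2) > 0" for y using d by (simp add: less_max_iff_disj)
        then show "max (d\<^sup>2) ((norm (y - ?z))\<^sup>2) ^ 4 \<noteq> 0" for y by (metis less_irrefl zero_less_power)
      qed
      from integral_component_eq[OF this, of b] show ?thesis
        unfolding J_def by (simp add: KAB)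
    qed
    define \<delta>' where "\<delta>' = min \<delta> r / (norm h + 1)"
    have h1: "norm h + 1 > 0" using norm_ge_zero[of h] by linarith
    have "integral (cbox (- c) c) (\<lambda>y. (A y + B y) / ((norm (y - (v + h)))\<^sup>2) ^ 4) = 0"
    proof (rule kernel_integral_zero_along_segment[OF contA, of v r])
      show "A y = 0" "B y = 0" if "norm (y - v) < r" for y
        using H0[OF that] by (simp_all add: A_def B_def K_def oct.zero_right)
      show "norm h < r" using xr by (simp add: h_def)
      show "\<delta>' > 0" using \<delta>(1) xr(3) h1 by (simp add: \<delta>'_def)
      fix t assume t: "0 < t" "t < \<delta>'"
      then have "t * (norm h + 1) < min \<delta> r" using h1 by (simp add: \<delta>'_def pos_less_divide_eq)
      then have n: "norm (t *\<^sub>R h) < min \<delta> r" using t(1) by (simp add: algebra_simps)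
      then show "integral (cbox (- c) c) (\<lambda>y. (A y + t * B y) / ((norm (y - (v + t *\<^sub>R h)))\<^sup>2) ^ 4) = 0"
        using JAB[of t] J_near[of "v + t *\<^sub>R h"] by simp
    qed
    then show "J x 0 \<bullet> b = 0 \<bullet> b"
      using JAB[of 1] xr by (simp add: h_def)
  qed
  then have J0: "(J x \<longlongrightarrow> 0) (at_right 0)" using J_lim[of x] xr by simp
  have \<Phi>0: "(\<Phi> x \<longlongrightarrow> 0) (at_right 0)"
  proof (rule Lim_transform_eventually)
    show "((\<lambda>\<epsilon>. - J x \<epsilon>) \<longlongrightarrow> 0) (at_right 0)" using tendsto_minus[OF J0] by simp
    show "\<forall>\<^sub>F \<epsilon> in at_right 0. - J x \<epsilon> = \<Phi> x \<epsilon>"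
      using \<Phi>J by (auto simp: eventually_at_right_field intro!: exI[of _ 1])
  qed
  have "\<psi> x \<bullet> \<psi> x \<le> 0"
  proof (rule peaked_kernel_limit_nonpos[where s="\<lambda>y. \<psi> y \<bullet> \<psi> x" and x=x and a="- c" and b=c])
    show "continuous_on UNIV (\<lambda>y. \<psi> y \<bullet> \<psi> x)" by (intro continuous_intros cont\<psi>)
    show "x \<in> box (- c) c" using c x by auto
    show "((\<lambda>\<epsilon>. integral (cbox (- c) c) (\<lambda>y. \<epsilon> / ((norm (y - x))\<^sup>2 + \<epsilon>) ^ 5 * (\<psi> y \<bullet> \<psi> x))) \<longlongrightarrow> 0) (at_right 0)"
    proof (rule Lim_transform_eventually)
      show "((\<lambda>\<epsilon>. (\<Phi> x \<epsilon> \<bullet> \<psi> x) / 8) \<longlongrightarrow> 0) (at_right 0)"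
        by (rule tendsto_eq_intros \<Phi>0 refl | simp)+
      have "(\<Phi> x \<epsilon> \<bullet> \<psi> x) / 8 = integral (cbox (- c) c) (\<lambda>y. \<epsilon> / ((norm (y - x))\<^sup>2 + \<epsilon>) ^ 5 * (\<psi> y \<bullet> \<psi> x))"
        if "\<epsilon> > 0" for \<epsilon>
      proof -
        have N: "(norm (y - x))\<^sup>2 + \<epsilon> \<noteq> 0" for y
          using that by (metis add_nonneg_pos less_irrefl zero_le_power2)
        have "(\<lambda>y. (8 * \<epsilon> / ((norm (y - x))\<^sup>2 + \<epsilon>) ^ 5) *\<^sub>R \<psi> y) integrable_on cbox (- c) c"
          using N by (intro integrable_continuous continuous_intros
              continuous_on_subset[OF cont\<psi>] subset_UNIV; simp)
        from integral_linear[OF this bounded_linear_inner_left[of "\<psi> x"]]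
        have "\<Phi> x \<epsilon> \<bullet> \<psi> x = integral (cbox (- c) c) (\<lambda>y. 8 * (\<epsilon> / ((norm (y - x))\<^sup>2 + \<epsilon>) ^ 5 * (\<psi> y \<bullet> \<psi> x)))"
          unfolding \<Phi>_def by (simp add: o_def mult.assoc)
        then show ?thesis unfolding integral_mult_right by simp
      qed
      then show "\<forall>\<^sub>F \<epsilon> in at_right 0. (\<Phi> x \<epsilon> \<bullet> \<psi> x) / 8
          = integral (cbox (- c) c) (\<lambda>y. \<epsilon> / ((norm (y - x))\<^sup>2 + \<epsilon>) ^ 5 * (\<psi> y \<bullet> \<psi> x))"
        by (auto simp: eventually_at_right_field intro!: exI[of _ 1])
    qed
  qed (simp add: DIM_cart)
  then have "\<psi> x = 0" by (metis inner_gt_zero_iff not_le)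
  moreover have "\<kappa> ((norm (x - v))\<^sup>2) = 1" using xr by (intro \<kappa>(3)) (simp add: power_mono)
  ultimately show ?thesis by (simp add: \<psi>_def)
qed

section \<open>Imaginary units\<close>

lemma oct_e_in_unit_sphere: "p < i \<Longrightarrow> i \<le> 7 \<Longrightarrow> oct_e i \<in> unit_sphere p"
  unfolding unit_sphere_def
  by (intro CollectI exI[of _ "\<lambda>j. if j = i then 1 else 0"])
    (simp add: if_distrib[of "\<lambda>c. c *\<^sub>R _"] if_distrib[of "\<lambda>c. c\<^sup>2"] sum.delta cong: if_cong)

lemma uminus_in_unit_sphere:
  assumes "\<omega> \<in> unit_sphere p"
  shows "- \<omega> \<in> unit_sphere p"
proof -
  obtain c :: "nat \<Rightarrow> real" where "\<omega> = (\<Sum>i=p+1..7. c i *\<^sub>R oct_e i)" "(\<Sum>i=p+1..7. (c i)\<^sup>2) = 1"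
    using assms by (auto simp: unit_sphere_def)
  then show ?thesis
    unfolding unit_sphere_def by (intro CollectI exI[of _ "\<lambda>i. - c i"]) (simp add: sum_negf)
qed

lemma oct_e_in_paravecs: "i \<le> p \<Longrightarrow> oct_e i \<in> paravecs p"
  unfolding paravecs_def by (intro span_base) auto

lemma oct_e_mult_left_0 [simp]: "oct_e 0 \<odot> a = a"
  unfolding vec_eq_iff forall_8 by (simp add: oct_mult_nth) (simp add: oct_e_def axis_def)

lemma oct_conj_imaginary: "x $ 0 = 0 \<Longrightarrow> oct_conj x = - x"
  by (simp add: oct_conj_def)

lemma unit_sphere_imaginary:
  assumes "\<omega> \<in> unit_sphere p" "p \<le> 7"
  shows "\<omega> $ 0 = 0"
proof -
  have "oct_e 0 \<bullet> \<omega> = 0"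
    by (rule inner_paravecs_unit_sphere[OF oct_e_in_paravecs assms]) simp
  then show ?thesis by (simp add: oct_e_def inner_axis')
qed

lemma unit_sphere_mult_self:
  assumes "\<omega> \<in> unit_sphere p" "p \<le> 7"
  shows "\<omega> \<odot> (\<omega> \<odot> a) = - a"
proof -
  have "\<omega> \<bullet> \<omega> = 1" using norm_unit_sphere[OF assms(1)] by (simp add: norm_eq_1)
  then show ?thesis
    using oct_conj_mult_cancel[of \<omega> a] oct_conj_imaginary[OF unit_sphere_imaginary[OF assms]]
    by (simp add: oct.minus_left minus_equation_iff)
qed

lemma oct_e_unit_sphere_anticommute:
  assumes "\<omega> \<in> unit_sphere p" "p \<le> 6" "i \<in> {1..p}"
  shows "oct_e i \<odot> (\<omega> \<odot> a) = - (\<omega> \<odot> (oct_e i \<odot> a))"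
proof -
  have "oct_e i \<bullet> \<omega> = 0"
    using assms by (intro inner_paravecs_unit_sphere[OF oct_e_in_paravecs assms(1)]) auto
  moreover have "oct_e i $ 0 = 0"
    using of_nat_8_inj[of i 0] assms by (auto simp: oct_e_def axis_def)
  ultimately show ?thesis
    using oct_conj_mult_polarized[of "oct_e i" \<omega> a] unit_sphere_imaginary[OF assms(1)] assms(2)
    by (simp add: oct_conj_imaginary oct.minus_left eq_neg_iff_add_eq_0 add_eq_0_iff)
qed

text \<open>
  The eight-variable theory sums over \<open>Basis\<close>, which frees it from the numbering of the
  coordinates; slices need the numbering.
\<close>

lemma Basis_oct: "(Basis :: oct set) = oct_e ` {..7}"
proof -
  have "(Basis :: oct set) = (\<lambda>i. axis i 1) ` UNIV" by (auto simp: Basis_vec_def)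
  also have "UNIV = (of_nat ` {..7} :: 8 set)" unfolding UNIV_8 atMost_7 by simp
  finally show ?thesis by (auto simp: oct_e_def)
qed

lemma inj_on_oct_e: "inj_on oct_e {..7}"
proof (rule inj_onI)
  fix i j assume "i \<in> {..7::nat}" "j \<in> {..7::nat}" "oct_e i = oct_e j"
  then show "i = j" using inner_oct_e[of i j] inner_oct_e[of j j] by (auto split: if_splits)
qed

lemma sum_Basis_oct: "(\<Sum>b\<in>Basis. f b) = (\<Sum>i\<le>7. f (oct_e i))"
  unfolding Basis_oct by (simp add: sum.reindex[OF inj_on_oct_e])

section \<open>Partial derivatives in the slice parameters\<close>

text \<open>
  \<open>C1_on\<close> with the derivatives as explicit parameters, so that the rules of calculus can produce
  them.
\<close>

definition has_partials ::
    "nat \<Rightarrow> (oct \<times> real) set \<Rightarrow> (oct \<times> real \<Rightarrow> oct) \<Rightarrow> (nat \<Rightarrow> oct \<times> real \<Rightarrow> oct) \<Rightarrow> (oct \<times> real \<Rightarrow> oct) \<Rightarrow> bool"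
  where "has_partials p D F G H \<longleftrightarrow>
    (\<forall>i\<le>p. (\<forall>z\<in>D. ((\<lambda>t. F (fst z + t *\<^sub>R oct_e i, snd z)) has_vector_derivative G i z) (at 0))
        \<and> continuous_on D (G i))
    \<and> (\<forall>z\<in>D. ((\<lambda>t. F (fst z, t)) has_vector_derivative H z) (at (snd z)))
    \<and> continuous_on D H"

lemma C1_on_iff_has_partials:
  "C1_on p D F \<longleftrightarrow> has_partials p D F (\<lambda>i. partial_x i F) (partial_r F)"
  unfolding C1_on_def has_partials_def partial_x_def partial_r_def
  by (auto simp: vector_derivative_works)

lemma has_partials_xD:
  assumes "has_partials p D F G H" "z \<in> D" "i \<le> p"
  shows "((\<lambda>t. F (fst z + t *\<^sub>R oct_e i, snd z)) has_vector_derivative G i z) (at 0)"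
  using assms by (auto simp: has_partials_def)

lemma has_partials_eq:
  assumes "has_partials p D F G H" "z \<in> D"
  shows "i \<le> p \<Longrightarrow> partial_x i F z = G i z" "partial_r F z = H z"
  using assms unfolding has_partials_def partial_x_def partial_r_def
  by (auto intro!: vector_derivative_at)

lemma has_partials_C1_on:
  assumes "has_partials p D F G H"
  shows "C1_on p D F"
proof -
  have "continuous_on D (partial_x i F)" if "i \<le> p" for i
    using assms that has_partials_eq(1)[OF assms _ that]
    by (auto simp: has_partials_def cong: continuous_on_cong)
  moreover have "continuous_on D (partial_r F)"
    using assms has_partials_eq(2)[OF assms] by (auto simp: has_partials_def cong: continuous_on_cong)
  ultimately show ?thesis
    using assms unfolding C1_on_def has_partials_def by (auto intro: differentiableI_vector)
qed

lemma has_partials_add: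
  assumes "has_partials p D F1 G1 H1" "has_partials p D F2 G2 H2"
  shows "has_partials p D (\<lambda>z. F1 z + F2 z) (\<lambda>i z. G1 i z + G2 i z) (\<lambda>z. H1 z + H2 z)"
  using assms unfolding has_partials_def
  by (auto intro!: has_vector_derivative_add continuous_intros)

lemma has_partials_linear:
  assumes "has_partials p D F G H" "bounded_linear L"
  shows "has_partials p D (\<lambda>z. L (F z)) (\<lambda>i z. L (G i z)) (\<lambda>z. L (H z))"
  using assms unfolding has_partials_def
  by (auto intro!: bounded_linear.has_vector_derivative[OF assms(2)] bounded_linear.continuous_on[OF assms(2)])

lemma has_partials_reflect:
  assumes F: "has_partials p D F G H" and D: "\<And>x r. (x, r) \<in> D \<Longrightarrow> (x, - r) \<in> D"
  shows "has_partials p D (\<lambda>z. F (fst z, - snd z)) (\<lambda>i z. G i (fst z, - snd z)) (\<lambda>z. - H (fst z, - snd z))"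
proof -
  have cont: "continuous_on D (\<lambda>z. K (fst z, - snd z))" if "continuous_on D K" for K :: "oct \<times> real \<Rightarrow> oct"
    by (rule continuous_on_compose2[OF that]) (use D in \<open>auto intro!: continuous_intros\<close>)
  have "((\<lambda>t. F (fst z, - t)) has_vector_derivative - H (fst z, - snd z)) (at (snd z))" if "z \<in> D" for z
  proof -
    have "(fst z, - snd z) \<in> D" using D that by (cases z) auto
    then have "((\<lambda>t. F (fst z, t)) has_vector_derivative H (fst z, - snd z)) (at (- snd z))"
      using F by (auto simp: has_partials_def)
    then have "((\<lambda>t. F (fst z, t)) \<circ> uminus has_vector_derivative (- 1) *\<^sub>R H (fst z, - snd z)) (at (snd z))"
      by (intro vector_diff_chain_at) (auto intro!: derivative_eq_intros)
    then show ?thesis by (simp add: o_def)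
  qed
  moreover have "((\<lambda>t. F (fst z + t *\<^sub>R oct_e i, - snd z)) has_vector_derivative G i (fst z, - snd z)) (at 0)"
    if "z \<in> D" "i \<le> p" for z i
  proof -
    have "(fst z, - snd z) \<in> D" using D that by (cases z) auto
    then show ?thesis using F that by (force simp: has_partials_def)
  qed
  ultimately show ?thesis
    using F unfolding has_partials_def by (auto intro!: cont continuous_on_minus)
qed

text \<open>
  Relatively open sets contain small coordinate segments, so that partial derivatives do not
  depend on values outside the domain.
\<close>

lemma open_lines:
  assumes D: "openin (top_of_set (param_space p)) D" and z: "z \<in> D"
  shows "i \<le> p \<Longrightarrow> \<exists>T. open T \<and> 0 \<in> T \<and> (\<forall>t\<in>T. (fst z + t *\<^sub>R oct_e i, snd z) \<in> D)"
    and "\<exists>T. open T \<and> snd z \<in> T \<and> (\<forall>t\<in>T. (fst z, t) \<in> D)"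
proof -
  obtain O' where O': "open O'" "D = param_space p \<inter> O'" using D by (auto simp: openin_open)
  have zp: "fst z \<in> paravecs p" using z O' by (auto simp: param_space_def)
  show "\<exists>T. open T \<and> 0 \<in> T \<and> (\<forall>t\<in>T. (fst z + t *\<^sub>R oct_e i, snd z) \<in> D)" if "i \<le> p"
  proof (intro exI conjI ballI)
    show "open ((\<lambda>t. (fst z + t *\<^sub>R oct_e i, snd z)) -` O')"
      by (intro open_vimage O' continuous_intros)
    show "(fst z + t *\<^sub>R oct_e i, snd z) \<in> D" if "t \<in> (\<lambda>t. (fst z + t *\<^sub>R oct_e i, snd z)) -` O'" for t
      using that zp oct_e_in_paravecs[OF \<open>i \<le> p\<close>]
      by (auto simp: O'(2) param_space_def paravecs_def intro: span_add span_scale)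
  qed (use z O' in auto)
  show "\<exists>T. open T \<and> snd z \<in> T \<and> (\<forall>t\<in>T. (fst z, t) \<in> D)"
  proof (intro exI conjI ballI)
    show "open ((\<lambda>t. (fst z, t)) -` O')" by (intro open_vimage O' continuous_intros)
    show "(fst z, t) \<in> D" if "t \<in> (\<lambda>t. (fst z, t)) -` O'" for t
      using that zp by (auto simp: O'(2) param_space_def)
  qed (use z O' in auto)
qed

lemma has_partials_cong:
  assumes F: "has_partials p D F G H" and D: "openin (top_of_set (param_space p)) D"
    and eq: "\<And>z. z \<in> D \<Longrightarrow> F' z = F z"
  shows "has_partials p D F' G H"
proof -
  have "((\<lambda>t. F' (fst z + t *\<^sub>R oct_e i, snd z)) has_vector_derivative G i z) (at 0)" if z: "z \<in> D" "i \<le> p" for z i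
  proof -
    obtain T where T: "open T" "0 \<in> T" "\<forall>t\<in>T. (fst z + t *\<^sub>R oct_e i, snd z) \<in> D"
      using open_lines(1)[OF D z] by blast
    have "((\<lambda>t. F (fst z + t *\<^sub>R oct_e i, snd z)) has_vector_derivative G i z) (at 0)"
      using F z by (auto simp: has_partials_def)
    then show ?thesis
      by (rule has_vector_derivative_transform_within_open[OF _ T(1,2)]) (use T eq in auto)
  qed
  moreover have "((\<lambda>t. F' (fst z, t)) has_vector_derivative H z) (at (snd z))" if z: "z \<in> D" for z
  proof -
    obtain T where T: "open T" "snd z \<in> T" "\<forall>t\<in>T. (fst z, t) \<in> D"
      using open_lines(2)[OF D z] by blast
    have "((\<lambda>t. F (fst z, t)) has_vector_derivative H z) (at (snd z))"
      using F z by (auto simp: has_partials_def)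
    then show ?thesis
      by (rule has_vector_derivative_transform_within_open[OF _ T(1,2)]) (use T eq in auto)
  qed
  ultimately show ?thesis using F by (auto simp: has_partials_def)
qed

section \<open>Slices of a symmetric completion\<close>

text \<open>
  A point with \<open>r < 0\<close> on the slice through \<open>\<omega>\<close> has the coordinate \<open>- r > 0\<close> on the slice through
  \<open>- \<omega>\<close>; reflection invariance of \<open>D\<close> makes the two descriptions agree.
\<close>

lemma slice_dom_p_completion:
  assumes "p \<le> 6" "reflection_invariant_open p D" "\<omega> \<in> unit_sphere p"
  shows "slice_dom p (p_completion p D) \<omega> = D"
proof -
  have sub: "D \<subseteq> param_space p" and mirror: "\<And>x r. (x, r) \<in> D \<Longrightarrow> (x, - r) \<in> D"
    using assms(2) by (auto simp: reflection_invariant_open_def dest: openin_imp_subset)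
  have nonneg: "(x, r) \<in> D" if x: "x \<in> paravecs p" "r \<ge> 0" "\<eta> \<in> unit_sphere p" "x + r *\<^sub>R \<eta> \<in> p_completion p D" for x r \<eta>
  proof -
    obtain y s \<zeta> where h: "\<zeta> \<in> unit_sphere p" "s \<ge> 0" "(y, s) \<in> D" "x + r *\<^sub>R \<eta> = y + s *\<^sub>R \<zeta>"
      using x(4) unfolding p_completion_def by blast
    have "y \<in> paravecs p" using h(3) sub by (auto simp: param_space_def)
    then show ?thesis
      using p_completion_decomp_unique(1,2)[of x p y \<eta> \<zeta> r s] x h assms(1) by auto
  qed
  have eq: "x + r *\<^sub>R \<omega> = x + (- r) *\<^sub>R (- \<omega>)" for x r by simp
  show ?thesis
  proof (intro set_eqI iffI)
    fix z assume z: "z \<in> slice_dom p (p_completion p D) \<omega>"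
    obtain x r where [simp]: "z = (x, r)" by (cases z)
    have x: "x \<in> paravecs p" "x + r *\<^sub>R \<omega> \<in> p_completion p D"
      using z by (auto simp: slice_dom_def param_space_def)
    show "z \<in> D"
    proof (cases "r \<ge> 0")
      case True
      then show ?thesis using nonneg[OF x(1) _ assms(3) x(2)] by simp
    next
      case False
      have "x + (- r) *\<^sub>R (- \<omega>) \<in> p_completion p D" using x(2) by simp
      then have "(x, - r) \<in> D" using nonneg[OF x(1) _ uminus_in_unit_sphere[OF assms(3)]] False by simp
      then show ?thesis using mirror[of x "- r"] by simp
    qed
  next
    fix z assume z: "z \<in> D"
    obtain x r where [simp]: "z = (x, r)" by (cases z)
    have "x + r *\<^sub>R \<omega> \<in> p_completion p D"
    proof (cases "r \<ge> 0")
      case True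
      then show ?thesis using z assms(3) by (auto simp: p_completion_def)
    next
      case False
      then show ?thesis
        unfolding eq p_completion_def using mirror[of x r] z uminus_in_unit_sphere[OF assms(3)]
        by (intro CollectI exI[of _ x] exI[of _ "- r"] exI[of _ "- \<omega>"]) simp
    qed
    then show "z \<in> slice_dom p (p_completion p D) \<omega>"
      using z sub by (auto simp: slice_dom_def)
  qed
qed

text \<open>
  The parity of the stem function extends the formula for the induced function from \<open>r \<ge> 0\<close> to the
  whole slice.
\<close>

lemma induced_on_slice:
  assumes "p \<le> 6" "reflection_invariant_open p D" "stem D F1 F2" "\<omega> \<in> unit_sphere p" "z \<in> D"
  shows "slice_fun (induced p D F1 F2) \<omega> z = F1 z + \<omega> \<odot> F2 z"
proof -
  obtain x r where z: "z = (x, r)" by (cases z)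
  show ?thesis
  proof (cases "r \<ge> 0")
    case True
    then show ?thesis using induced_apply[OF assms(1-4)] assms(5) by (simp add: z slice_fun_def)
  next
    case False
    have m: "(x, - r) \<in> D" using assms by (auto simp: z reflection_invariant_open_def)
    have "induced p D F1 F2 (x + (- r) *\<^sub>R (- \<omega>)) = F1 (x, - r) + (- \<omega>) \<odot> F2 (x, - r)"
      using False by (intro induced_apply[OF assms(1-3)] uminus_in_unit_sphere assms m) auto
    moreover have "F1 (x, - r) = F1 (x, r)" "F2 (x, - r) = - F2 (x, r)"
      using assms(3,5) unfolding stem_def z by blast+
    ultimately show ?thesis by (simp add: z slice_fun_def oct.minus_left oct.minus_right)
  qed
qed

section \<open>Extension by zero across the reflection hyperplane\<close>

lemma has_partials_tangential_zero:
  assumes F: "has_partials p D F G H" and D: "openin (top_of_set (param_space p)) D"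
    and zero: "\<And>x. (x, 0) \<in> D \<Longrightarrow> F (x, 0) = 0" and x: "(x, 0) \<in> D" and i: "i \<le> p"
  shows "G i (x, 0) = 0"
proof -
  obtain T where T: "open T" "0 \<in> T" "\<forall>t\<in>T. (x + t *\<^sub>R oct_e i, 0) \<in> D"
    using open_lines(1)[OF D x i] by auto
  have "((\<lambda>t. F (x + t *\<^sub>R oct_e i, 0)) has_vector_derivative 0) (at 0)"
    by (rule has_vector_derivative_transform_within_open[OF has_vector_derivative_const T(1,2), of 0])
      (use T zero in auto)
  moreover have "((\<lambda>t. F (x + t *\<^sub>R oct_e i, 0)) has_vector_derivative G i (x, 0)) (at 0)"
    using has_partials_xD[OF F x i] by simp
  ultimately show ?thesis using vector_derivative_unique_at by metis
qed

definition upper_part :: "(oct \<times> real \<Rightarrow> oct) \<Rightarrow> oct \<times> real \<Rightarrow> oct"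
  where "upper_part F z = (if snd z > 0 then F z else 0)"

lemma continuous_on_upper_part:
  assumes "continuous_on D F" "\<And>x. (x, 0) \<in> D \<Longrightarrow> F (x, 0) = 0"
  shows "continuous_on D (upper_part F)"
proof -
  have "continuous_on (D \<inter> {z. snd z \<ge> 0} \<union> D \<inter> {z. snd z \<le> 0}) (\<lambda>z. if snd z \<ge> 0 then F z else 0)"
  proof (rule continuous_on_cases_local)
    show "closedin (top_of_set (D \<inter> {z. snd z \<ge> 0} \<union> D \<inter> {z. snd z \<le> 0})) (D \<inter> {z. snd z \<ge> 0})"
      "closedin (top_of_set (D \<inter> {z. snd z \<ge> 0} \<union> D \<inter> {z. snd z \<le> 0})) (D \<inter> {z. snd z \<le> 0})"
      unfolding closedin_closed
      by (rule exI[of _ "{z. snd z \<ge> 0}"] exI[of _ "{z. snd z \<le> 0}"];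
          auto intro!: closed_Collect_le continuous_intros)+
  qed (use assms in \<open>auto intro: continuous_on_subset\<close>)
  moreover have "D \<inter> {z. snd z \<ge> 0} \<union> D \<inter> {z. snd z \<le> 0} = D" by auto
  ultimately show ?thesis
    using assms(2)
    by (auto simp: upper_part_def elim!: continuous_on_eq)
qed

text \<open>
  A function that vanishes to first order on the hyperplane \<open>r = 0\<close> can be continued from
  \<open>r > 0\<close> by zero without losing continuous differentiability. The derivative in \<open>r\<close> vanishes there
  by assumption, the tangential ones do so along with the function.
\<close>

lemma has_partials_upper_part:
  assumes F: "has_partials p D F G H" and D: "openin (top_of_set (param_space p)) D"
    and zero: "\<And>x. (x, 0) \<in> D \<Longrightarrow> F (x, 0) = 0" and H0: "\<And>x. (x, 0) \<in> D \<Longrightarrow> H (x, 0) = 0"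
  shows "has_partials p D (upper_part F) (\<lambda>i. upper_part (G i)) (upper_part H)"
proof -
  have G0: "G i (x, 0) = 0" if "i \<le> p" "(x, 0) \<in> D" for i x
    by (rule has_partials_tangential_zero[OF F D zero that(2,1)])
  have "((\<lambda>t. upper_part F (fst z + t *\<^sub>R oct_e i, snd z)) has_vector_derivative upper_part (G i) z) (at 0)"
    if "z \<in> D" "i \<le> p" for z i
    using F that by (auto simp: upper_part_def has_partials_def)
  moreover have "((\<lambda>t. upper_part F (fst z, t)) has_vector_derivative upper_part H z) (at (snd z))"
    if z: "z \<in> D" for z
  proof -
    have d: "((\<lambda>t. F (fst z, t)) has_vector_derivative H z) (at (snd z))"
      using F z by (auto simp: has_partials_def)
    consider "snd z > 0" | "snd z < 0" | "snd z = 0" by linarith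
    then show ?thesis
    proof cases
      case 1
      then have u: "upper_part H z = H z" by (simp add: upper_part_def)
      show ?thesis unfolding u
        by (rule has_vector_derivative_transform_within_open[OF d, of "{0<..}"])
          (use 1 in \<open>auto simp: upper_part_def\<close>)
    next
      case 2
      then have u: "upper_part H z = 0" by (simp add: upper_part_def)
      show ?thesis unfolding u
        by (rule has_vector_derivative_transform_within_open[OF has_vector_derivative_const, of "{..<0}" _ 0])
          (use 2 in \<open>auto simp: upper_part_def\<close>)
    next
      case 3
      \<comment> \<open>On the hyperplane the difference quotient of \<open>upper_part F\<close> is dominated by that of \<open>F\<close>.\<close>
      obtain x where x: "z = (x, 0)" using 3 by (cases z) auto
      have "((\<lambda>t. F (x, t)) has_vector_derivative 0) (at 0)"
        using d H0[of x] z by (simp add: x)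
      then have d0: "((\<lambda>t. norm (F (x, t)) / \<bar>t\<bar>) \<longlongrightarrow> 0) (at 0)"
        using zero[of x] z by (simp add: x has_vector_derivative_def has_derivative_at)
      have "((\<lambda>t. norm (upper_part F (x, t)) / \<bar>t\<bar>) \<longlongrightarrow> 0) (at 0)"
      proof (rule Lim_null_comparison[OF _ d0], rule always_eventually, rule allI)
        show "norm (norm (upper_part F (x, t)) / \<bar>t\<bar>) \<le> norm (F (x, t)) / \<bar>t\<bar>" for t
        proof -
          have "norm (upper_part F (x, t)) \<le> norm (F (x, t))" by (simp add: upper_part_def)
          then show ?thesis by (simp add: divide_right_mono)
        qed
      qed
      then have "((\<lambda>t. upper_part F (x, t)) has_vector_derivative 0) (at 0)"
        by (simp add: has_vector_derivative_def has_derivative_at) (simp add: upper_part_def)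
      then show ?thesis using 3 by (simp add: x upper_part_def)
    qed
  qed
  ultimately show ?thesis
    using F zero G0 H0 unfolding has_partials_def by (auto intro!: continuous_on_upper_part)
qed

section \<open>The identity theorem on a slice\<close>

definition paravec_proj :: "nat \<Rightarrow> oct \<Rightarrow> oct"
  where "paravec_proj p y = (\<Sum>i\<le>p. (y \<bullet> oct_e i) *\<^sub>R oct_e i)"

lemma paravec_proj_in_paravecs: "paravec_proj p y \<in> paravecs p"
  unfolding paravec_proj_def paravecs_def
  by (intro span_sum span_scale span_base) auto

lemma bounded_linear_paravec_proj: "bounded_linear (paravec_proj p)"
  unfolding paravec_proj_def
  by (intro bounded_linear_sum bounded_linear_scaleR_left bounded_linear_inner_left
      bounded_linear_compose[OF bounded_linear_scaleR_left])

lemma paravec_proj_eq: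
  assumes "x \<in> paravecs p" "\<omega> \<in> unit_sphere p" "p \<le> 6"
  shows "paravec_proj p (x + r *\<^sub>R \<omega>) = x"
proof -
  have s: "paravec_proj p \<omega> = 0"
    unfolding paravec_proj_def
    using assms inner_paravecs_unit_sphere[OF oct_e_in_paravecs assms(2)]
    by (intro sum.neutral) (auto simp: inner_commute)
  have e: "paravec_proj p (oct_e i) = oct_e i" if "i \<le> p" for i
  proof -
    have "paravec_proj p (oct_e i) = (\<Sum>j\<le>p. if i = j then oct_e j else 0)"
      unfolding paravec_proj_def using assms(3) that
      by (intro sum.cong refl) (simp add: inner_oct_e)
    then show ?thesis using that by simp
  qed
  have "paravec_proj p x = x"
    using assms(1) unfolding paravecs_def
  proof (induction rule: span_induct_alt)
    case base
    show ?case by (simp add: paravec_proj_def)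
  next
    case (step c b y)
    then show ?case
      using e by (auto simp: linear_add[OF bounded_linear.linear[OF bounded_linear_paravec_proj]]
          linear_scale[OF bounded_linear.linear[OF bounded_linear_paravec_proj]])
  qed
  then show ?thesis
    by (simp add: linear_add[OF bounded_linear.linear[OF bounded_linear_paravec_proj]]
          linear_scale[OF bounded_linear.linear[OF bounded_linear_paravec_proj]] s)
qed

lemma paravec_proj_line:
  assumes "i \<le> 7" "p \<le> 6"
  shows "paravec_proj p (y + t *\<^sub>R oct_e i) = paravec_proj p y + (if i \<le> p then t *\<^sub>R oct_e i else 0)"
proof -
  have "paravec_proj p (oct_e i) = (\<Sum>j\<le>p. if i = j then oct_e j else 0)"
    unfolding paravec_proj_def using assms by (intro sum.cong refl) (simp add: inner_oct_e)
  then have "paravec_proj p (oct_e i) = (if i \<le> p then oct_e i else 0)" by simp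
  then show ?thesis
    by (simp add: linear_add[OF bounded_linear.linear[OF bounded_linear_paravec_proj]]
          linear_scale[OF bounded_linear.linear[OF bounded_linear_paravec_proj]])
qed

text \<open>
  Both halves of \<open>D\<close> are continuous images of the completion, under
  \<open>x + r *\<^sub>R \<omega> \<mapsto> (x, r)\<close> and \<open>x + r *\<^sub>R \<omega> \<mapsto> (x, - r)\<close> with \<open>r \<ge> 0\<close>; the map \<open>\<sigma> s\<close> in the proof, with
  \<open>s = 1\<close> or \<open>s = - 1\<close>, writes these in terms of the projection to \<open>paravecs p\<close>.
\<close>

lemma connected_half_domains:
  assumes "p \<le> 6" "connected (p_completion p D)" "reflection_invariant_open p D"
  shows "connected {z \<in> D. snd z \<ge> 0}" "connected {z \<in> D. snd z \<le> 0}"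
proof -
  define \<sigma> where "\<sigma> s y = (paravec_proj p y, s * norm (y - paravec_proj p y))" for s :: real and y
  have sub: "D \<subseteq> param_space p" and mirror: "\<And>x r. (x, r) \<in> D \<Longrightarrow> (x, - r) \<in> D"
    using assms(3) by (auto simp: reflection_invariant_open_def dest: openin_imp_subset)
  have \<sigma>: "\<sigma> s (x + r *\<^sub>R \<omega>) = (x, s * r)" if "(x, r) \<in> D" "r \<ge> 0" "\<omega> \<in> unit_sphere p" for s x r \<omega>
  proof -
    have "x \<in> paravecs p" using that sub by (auto simp: param_space_def)
    then have "paravec_proj p (x + r *\<^sub>R \<omega>) = x" using that assms(1) by (intro paravec_proj_eq)
    then show ?thesis using that norm_unit_sphere[of \<omega> p] by (simp add: \<sigma>_def)
  qed
  obtain \<eta> where \<eta>: "\<eta> \<in> unit_sphere p" using oct_e_in_unit_sphere[of p 7] assms(1) by auto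
  have "continuous_on (p_completion p D) (\<sigma> s)" for s
    unfolding \<sigma>_def by (intro continuous_intros bounded_linear.continuous_on[OF bounded_linear_paravec_proj])
  then have conn: "connected (\<sigma> s ` p_completion p D)" for s
    by (rule connected_continuous_image) (rule assms)
  have im: "\<sigma> s ` p_completion p D = (\<lambda>(x, r). (x, s * r)) ` {z \<in> D. snd z \<ge> 0}" for s
  proof (intro set_eqI iffI)
    fix z assume "z \<in> \<sigma> s ` p_completion p D"
    then obtain x r \<omega> where h: "z = \<sigma> s (x + r *\<^sub>R \<omega>)" "\<omega> \<in> unit_sphere p" "r \<ge> 0" "(x, r) \<in> D"
      unfolding p_completion_def by blast
    then show "z \<in> (\<lambda>(x, r). (x, s * r)) ` {z \<in> D. snd z \<ge> 0}"
      using \<sigma> by (intro image_eqI[of _ _ "(x, r)"]) auto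
  next
    fix z assume "z \<in> (\<lambda>(x, r). (x, s * r)) ` {z \<in> D. snd z \<ge> 0}"
    then obtain w where "w \<in> {z \<in> D. snd z \<ge> 0}" "z = (\<lambda>(x, r). (x, s * r)) w" by blast
    then obtain x r where h: "z = (x, s * r)" "(x, r) \<in> D" "r \<ge> 0"
      by (intro that[of "fst w" "snd w"]) (auto simp: split_beta)
    then have "z = \<sigma> s (x + r *\<^sub>R \<eta>)" using \<sigma> \<eta> by simp
    then show "z \<in> \<sigma> s ` p_completion p D" using h \<eta> unfolding p_completion_def by blast
  qed
  have "(\<lambda>(x, r). (x, 1 * r)) ` {z \<in> D. snd z \<ge> 0} = {z \<in> D. snd z \<ge> 0}" by force
  then show "connected {z \<in> D. snd z \<ge> 0}" using conn[of 1] im by simp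
  have "(\<lambda>(x, r). (x, - 1 * r)) ` {z \<in> D. snd z \<ge> 0} = {z \<in> D. snd z \<le> 0}"
  proof (intro set_eqI iffI)
    fix z assume z: "z \<in> {z \<in> D. snd z \<le> 0}"
    then show "z \<in> (\<lambda>(x, r). (x, - 1 * r)) ` {z \<in> D. snd z \<ge> 0}"
      using mirror by (intro image_eqI[of _ _ "(fst z, - snd z)"]) (cases z; auto)+
  qed (use mirror in auto)
  then show "connected {z \<in> D. snd z \<le> 0}" using conn[of "- 1"] im by simp
qed

lemma connected_param_domain:
  assumes "p \<le> 6" "connected (p_completion p D)" "reflection_invariant_open p D" "(x, 0) \<in> D"
  shows "connected D"
proof -
  have "connected ({z \<in> D. snd z \<ge> 0} \<union> {z \<in> D. snd z \<le> 0})"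
    using connected_half_domains[OF assms(1-3)] assms(4) by (intro connected_Un) auto
  moreover have "{z \<in> D. snd z \<ge> 0} \<union> {z \<in> D. snd z \<le> 0} = D" by auto
  ultimately show ?thesis by simp
qed

text \<open>
  The lift \<open>U = F \<circ> \<pi>\<close> to eight variables is constant in the directions orthogonal to the slice. For
  \<open>i > p\<close> its derivative along \<open>oct_e i\<close> is \<open>(oct_e i \<bullet> \<omega>) *\<^sub>R H\<close>, and these contribute \<open>\<omega> \<odot> H\<close> to
  the Dirac operator, so \<open>U\<close> solves the equation in eight variables. By the local statement the
  relative interior of the zero set of \<open>F\<close> is closed in \<open>D\<close>.
\<close>

lemma slice_identity_theorem:
  assumes p: "p \<le> 6" and D: "openin (top_of_set (param_space p)) D" "connected D"
    and \<omega>: "\<omega> \<in> unit_sphere p"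
    and F: "has_partials p D F G H"
    and eq: "\<And>z. z \<in> D \<Longrightarrow> (\<Sum>i=0..p. oct_e i \<odot> G i z) + \<omega> \<odot> H z = 0"
    and z0: "z0 \<in> D" "\<rho>0 > 0" "\<And>w. w \<in> D \<Longrightarrow> dist z0 w < \<rho>0 \<Longrightarrow> F w = 0"
    and z: "z \<in> D"
  shows "F z = 0"
proof -
  define \<iota> where "\<iota> z = fst z + snd z *\<^sub>R \<omega>" for z :: "oct \<times> real"
  define \<pi> where "\<pi> y = (paravec_proj p y, y \<bullet> \<omega>)" for y
  obtain O' where O': "open O'" "D = param_space p \<inter> O'" using D(1) by (auto simp: openin_open)
  have \<pi>p: "\<pi> y \<in> param_space p" for y
    by (simp add: \<pi>_def param_space_def paravec_proj_in_paravecs)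
  have \<pi>cont: "continuous_on S \<pi>" for S
    unfolding \<pi>_def by (intro continuous_intros bounded_linear.continuous_on[OF bounded_linear_paravec_proj])
  have \<omega>\<omega>: "\<omega> \<bullet> \<omega> = 1" using norm_unit_sphere[OF \<omega>] by (simp add: norm_eq_1)
  have \<pi>\<iota>: "\<pi> (\<iota> w) = w" if "w \<in> D" for w
  proof -
    have x: "fst w \<in> paravecs p" using that O'(2) by (auto simp: param_space_def)
    then show ?thesis
      using paravec_proj_eq[OF x \<omega> p, of "snd w"] inner_paravecs_unit_sphere[OF x \<omega>] p \<omega>\<omega>
      by (simp add: \<pi>_def \<iota>_def inner_add_left)
  qed
  have \<iota>dist: "dist (\<iota> u) (\<iota> w) \<le> dist u w" if "u \<in> D" "w \<in> D" for u w
  proof -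
    have x: "fst u - fst w \<in> paravecs p"
      using that O'(2) by (auto simp: param_space_def paravecs_def intro: span_diff)
    have o: "(fst u - fst w) \<bullet> \<omega> = 0" using inner_paravecs_unit_sphere[OF x \<omega>] p by simp
    have "\<iota> u - \<iota> w = (fst u - fst w) + (snd u - snd w) *\<^sub>R \<omega>"
      by (simp add: \<iota>_def algebra_simps)
    then have "(norm (\<iota> u - \<iota> w))\<^sup>2 = (norm (fst u - fst w))\<^sup>2 + (snd u - snd w)\<^sup>2"
      unfolding power2_norm_eq_inner
      using o by (simp add: inner_add_left inner_add_right inner_commute \<omega>\<omega> power2_eq_square)
    also have "\<dots> = (norm (u - w))\<^sup>2"
      by (cases u; cases w) (simp add: norm_Pair)
    finally show ?thesis by (simp add: dist_norm)
  qed
  define W where "W = \<pi> -` O'"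
  have W: "open W" unfolding W_def by (rule open_vimage[OF O'(1) \<pi>cont])
  have \<pi>W: "\<pi> y \<in> D" if "y \<in> W" for y using that \<pi>p O'(2) by (auto simp: W_def)
  have \<iota>W: "\<iota> w \<in> W" if "w \<in> D" for w using \<pi>\<iota>[OF that] that O'(2) by (simp add: W_def)
  define U where "U y = F (\<pi> y)" for y
  \<comment> \<open>The second summand vanishes for \<open>oct_e i\<close> with \<open>i \<le> p\<close>, the first one for the other basis
      elements; in this form the Dirac sum splits into the two parts of the slice operator.\<close>
  define U' where "U' b y = (if b \<in> oct_e ` {..p} then G (inv_into {..7} oct_e b) (\<pi> y) else 0)
    + (b \<bullet> \<omega>) *\<^sub>R H (\<pi> y)" for b y
  have U'e: "U' (oct_e i) y = (if i \<le> p then G i (\<pi> y) else 0) + (oct_e i \<bullet> \<omega>) *\<^sub>R H (\<pi> y)"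
    if "i \<le> 7" for i y
  proof -
    have "oct_e i \<in> oct_e ` {..p} \<longleftrightarrow> i \<le> p"
      using inj_on_image_mem_iff[OF inj_on_oct_e, of i "{..p}"] that p by auto
    then show ?thesis
      using inv_into_f_f[OF inj_on_oct_e, of i] that by (simp add: U'_def)
  qed
  have orth: "oct_e i \<bullet> \<omega> = 0" if "i \<le> p" for i
    using inner_paravecs_unit_sphere[OF oct_e_in_paravecs[OF that] \<omega>] p by simp
  have derivU: "((\<lambda>t. U (y + t *\<^sub>R b)) has_vector_derivative U' b y) (at 0)"
    if y: "y \<in> W" and b: "b \<in> Basis" for y b
  proof -
    obtain i where i: "b = oct_e i" "i \<le> 7" using b unfolding Basis_oct by auto
    show ?thesis
    proof (cases "i \<le> p")
      case True
      have "\<pi> (y + t *\<^sub>R b) = (fst (\<pi> y) + t *\<^sub>R oct_e i, snd (\<pi> y))" for t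
        using paravec_proj_line[OF i(2) p] True orth[OF True]
        by (simp add: \<pi>_def i(1) inner_add_left)
      moreover have "((\<lambda>t. F (fst (\<pi> y) + t *\<^sub>R oct_e i, snd (\<pi> y))) has_vector_derivative G i (\<pi> y)) (at 0)"
        by (rule has_partials_xD[OF F \<pi>W[OF y] True])
      ultimately show ?thesis using U'e[OF i(2)] True orth[OF True] by (simp add: U_def i(1))
    next
      case False
      define c where "c = oct_e i \<bullet> \<omega>"
      have "\<pi> (y + t *\<^sub>R b) = (fst (\<pi> y), snd (\<pi> y) + t * c)" for t
        using paravec_proj_line[OF i(2) p] False
        by (simp add: \<pi>_def i(1) inner_add_left c_def)
      moreover have "((\<lambda>t. F (fst (\<pi> y), t)) \<circ> (\<lambda>t. snd (\<pi> y) + t * c) has_vector_derivative c *\<^sub>R H (\<pi> y)) (at 0)"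
      proof (rule vector_diff_chain_at)
        show "((\<lambda>t. F (fst (\<pi> y), t)) has_vector_derivative H (\<pi> y)) (at (snd (\<pi> y) + 0 * c))"
          using F \<pi>W[OF y] by (auto simp: has_partials_def)
      qed (auto intro!: derivative_eq_intros)
      ultimately show ?thesis using U'e[OF i(2)] False by (simp add: U_def i(1) o_def c_def)
    qed
  qed
  have contG: "continuous_on W (\<lambda>y. G i (\<pi> y))" if "i \<le> p" for i
    by (rule continuous_on_compose2[OF _ \<pi>cont, of D]) (use F \<pi>W that in \<open>auto simp: has_partials_def\<close>)
  have contH: "continuous_on W (\<lambda>y. H (\<pi> y))"
    by (rule continuous_on_compose2[OF _ \<pi>cont, of D]) (use F \<pi>W in \<open>auto simp: has_partials_def\<close>)
  have contU: "continuous_on W (U' b)" if b: "b \<in> Basis" for b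
  proof -
    obtain i where i: "b = oct_e i" "i \<le> 7" using b unfolding Basis_oct by auto
    show ?thesis
      unfolding i(1) U'e[OF i(2)]
      by (cases "i \<le> p") (auto intro!: continuous_intros contG contH)
  qed
  have diracU: "(\<Sum>b\<in>Basis. b \<odot> U' b y) = 0" if y: "y \<in> W" for y
  proof -
    have "(\<Sum>b\<in>Basis. b \<odot> U' b y) = (\<Sum>i\<le>7. oct_e i \<odot> (if i \<le> p then G i (\<pi> y) else 0))
        + (\<Sum>i\<le>7. (\<omega> \<bullet> oct_e i) *\<^sub>R oct_e i) \<odot> H (\<pi> y)"
      unfolding sum_Basis_oct oct.sum_left
      by (simp add: U'e oct.add_right oct.scaleR_right oct.scaleR_left sum.distrib inner_commute)
    also have "(\<Sum>i\<le>7. oct_e i \<odot> (if i \<le> p then G i (\<pi> y) else 0)) = (\<Sum>i=0..p. oct_e i \<odot> G i (\<pi> y))"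
      using p by (intro sum.mono_neutral_cong_right) (auto simp: oct.zero_right)
    also have "(\<Sum>i\<le>7. (\<omega> \<bullet> oct_e i) *\<^sub>R oct_e i) = \<omega>"
      unfolding sum_Basis_oct[symmetric, of "\<lambda>b. (\<omega> \<bullet> b) *\<^sub>R b"] by (rule euclidean_representation)
    finally show ?thesis using eq[OF \<pi>W[OF y]] by simp
  qed
  define Z where "Z = {u \<in> D. \<exists>\<rho>>0. \<forall>w\<in>D. dist u w < \<rho> \<longrightarrow> F w = 0}"
  have ball: "\<forall>w\<in>D. dist u w < R \<longrightarrow> F w = 0" if u: "u \<in> Z" and R: "cball (\<iota> u) R \<subseteq> W" for u R
  proof (intro ballI impI)
    fix w assume w: "w \<in> D" "dist u w < R"
    obtain \<rho> where \<rho>: "u \<in> D" "\<rho> > 0" "\<forall>w\<in>D. dist u w < \<rho> \<longrightarrow> F w = 0" using u by (auto simp: Z_def)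
    have "open (W \<inter> \<pi> -` ball u \<rho>)"
      by (intro open_Int W open_vimage[OF open_ball \<pi>cont])
    moreover have "\<iota> u \<in> W \<inter> \<pi> -` ball u \<rho>" using \<iota>W[OF \<rho>(1)] \<pi>\<iota>[OF \<rho>(1)] \<rho>(2) by simp
    ultimately obtain \<delta> where \<delta>: "\<delta> > 0" "ball (\<iota> u) \<delta> \<subseteq> W \<inter> \<pi> -` ball u \<rho>"
      using open_contains_ball by metis
    have U0: "U y = 0" if "y \<in> ball (\<iota> u) \<delta>" for y
    proof -
      have "y \<in> W" "\<pi> y \<in> ball u \<rho>" using \<delta>(2) that by auto
      then show ?thesis using \<pi>W \<rho>(3) by (simp add: U_def)
    qed
    have "\<iota> w \<in> ball (\<iota> u) R" using \<iota>dist[OF \<rho>(1) w(1)] w(2) by simp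
    from monogenic_zero_near_center_imp_zero_on_ball[OF W R derivU contU diracU \<delta>(1) U0 this]
    have "U (\<iota> w) = 0" .
    then show "F w = 0" using \<pi>\<iota>[OF w(1)] by (simp add: U_def)
  qed
  have "openin (top_of_set D) Z"
    unfolding openin_contains_ball
  proof (intro conjI ballI)
    fix u assume "u \<in> Z"
    then obtain \<rho> where \<rho>: "\<rho> > 0" "\<forall>w\<in>D. dist u w < \<rho> \<longrightarrow> F w = 0" by (auto simp: Z_def)
    have "u' \<in> Z" if "u' \<in> D" "dist u u' < \<rho> / 2" for u'
    proof -
      have "dist u w < \<rho>" if "dist u' w < \<rho> / 2" for w
        using dist_triangle[of u w u'] \<open>dist u u' < \<rho> / 2\<close> that by simp
      then have "\<rho> / 2 > 0 \<and> (\<forall>w\<in>D. dist u' w < \<rho> / 2 \<longrightarrow> F w = 0)" using \<rho> by simp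
      then show ?thesis using \<open>u' \<in> D\<close> unfolding Z_def by blast
    qed
    then show "\<exists>e>0. ball u e \<inter> D \<subseteq> Z" using \<rho>(1) by (intro exI[of _ "\<rho> / 2"]) auto
  qed (auto simp: Z_def)
  moreover have "closedin (top_of_set D) Z"
    unfolding closedin_limpt
  proof (intro conjI allI impI)
    fix u assume u: "u islimpt Z \<and> u \<in> D"
    obtain R where R: "R > 0" "cball (\<iota> u) R \<subseteq> W"
      using W \<iota>W u open_contains_cball by metis
    obtain u' where u': "u' \<in> Z" "dist u' u < R / 2"
      using u R(1) unfolding islimpt_approachable by (meson half_gt_zero)
    have "cball (\<iota> u') (R / 2) \<subseteq> W"
    proof
      fix y assume "y \<in> cball (\<iota> u') (R / 2)"
      moreover have "dist (\<iota> u') (\<iota> u) < R / 2" using \<iota>dist[of u' u] u u' by (auto simp: Z_def)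
      ultimately have "dist (\<iota> u) y \<le> R"
        using dist_triangle[of "\<iota> u" y "\<iota> u'"] dist_commute[of "\<iota> u" "\<iota> u'"] by simp
      then show "y \<in> W" using R(2) by auto
    qed
    from ball[OF u'(1) this] have z: "\<forall>w\<in>D. dist u' w < R / 2 \<longrightarrow> F w = 0" .
    have "F w = 0" if "w \<in> D" "dist u w < R / 2 - dist u' u" for w
      using z that dist_triangle[of u' w u] by simp
    then have "R / 2 - dist u' u > 0 \<and> (\<forall>w\<in>D. dist u w < R / 2 - dist u' u \<longrightarrow> F w = 0)"
      using u'(2) by simp
    then show "u \<in> Z" using u unfolding Z_def by blast
  qed (auto simp: Z_def)
  moreover have "z0 \<in> Z" using z0 by (auto simp: Z_def)
  ultimately have "Z = D" using D(2) unfolding connected_clopen by blast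
  with z have "z \<in> Z" by simp
  then obtain \<rho> where "\<rho> > 0" "\<forall>w\<in>D. dist z w < \<rho> \<longrightarrow> F w = 0" by (auto simp: Z_def)
  then show ?thesis using z by simp
qed

section \<open>Comparison of the two function spaces\<close>

text \<open>
  In the slice operator applied to \<open>F1 + \<omega> \<odot> F2\<close>, anticommutation moves \<open>\<omega>\<close> to the left of the
  tangential derivatives of \<open>F2\<close>, which turns the operator acting on \<open>F2\<close> into its conjugate. The
  result cancels against \<open>\<omega> \<odot> H1\<close> by one equation; the tangential part of \<open>F1\<close> cancels against
  \<open>\<omega> \<odot> (\<omega> \<odot> H2) = - H2\<close> by the other.
\<close>

lemma induced_in_GSM:
  assumes p: "p \<le> 6" and D: "reflection_invariant_open p D" and st: "stem D F1 F2"
    and F1: "has_partials p D F1 G1 H1" and F2: "has_partials p D F2 G2 H2"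
    and eq1: "\<And>z. z \<in> D \<Longrightarrow> (\<Sum>i=0..p. oct_e i \<odot> G1 i z) - H2 z = 0"
    and eq2: "\<And>z. z \<in> D \<Longrightarrow> G2 0 z - (\<Sum>i=1..p. oct_e i \<odot> G2 i z) + H1 z = 0"
  shows "induced p D F1 F2 \<in> GSM p (p_completion p D)"
  unfolding GSM_def
proof (intro CollectI conjI ballI)
  show "induced p D F1 F2 \<in> extensional (p_completion p D)" by (simp add: induced_def)
  fix \<omega> assume \<omega>: "\<omega> \<in> unit_sphere p"
  have open_D: "openin (top_of_set (param_space p)) D" using D by (simp add: reflection_invariant_open_def)
  have sd: "slice_dom p (p_completion p D) \<omega> = D" by (rule slice_dom_p_completion[OF p D \<omega>])
  have hp: "has_partials p D (slice_fun (induced p D F1 F2) \<omega>) (\<lambda>i z. G1 i z + \<omega> \<odot> G2 i z) (\<lambda>z. H1 z + \<omega> \<odot> H2 z)"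
    by (rule has_partials_cong[OF has_partials_add[OF F1 has_partials_linear[OF F2 oct.bounded_linear_right]] open_D])
      (rule induced_on_slice[OF p D st \<omega>])
  show "C1_on p (slice_dom p (p_completion p D) \<omega>) (slice_fun (induced p D F1 F2) \<omega>)"
    unfolding sd by (rule has_partials_C1_on[OF hp])
  fix z assume "z \<in> slice_dom p (p_completion p D) \<omega>"
  then have z: "z \<in> D" by (simp add: sd)
  have "(\<Sum>i=1..p. oct_e i \<odot> (\<omega> \<odot> G2 i z)) = - (\<omega> \<odot> (\<Sum>i=1..p. oct_e i \<odot> G2 i z))"
    using oct_e_unit_sphere_anticommute[OF \<omega> p] by (simp add: oct.sum_right sum_negf)
  then have "(\<Sum>i=0..p. oct_e i \<odot> (\<omega> \<odot> G2 i z)) = \<omega> \<odot> (G2 0 z - (\<Sum>i=1..p. oct_e i \<odot> G2 i z))"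
    by (simp add: sum.atLeast_Suc_atMost oct.diff_right)
  also have "G2 0 z - (\<Sum>i=1..p. oct_e i \<odot> G2 i z) = - H1 z"
    using eq2[OF z] by (simp only: eq_neg_iff_add_eq_0)
  also have "\<omega> \<odot> (- H1 z) = - (\<omega> \<odot> H1 z)" by (rule oct.minus_right)
  finally have 2: "(\<Sum>i=0..p. oct_e i \<odot> (\<omega> \<odot> G2 i z)) = - (\<omega> \<odot> H1 z)" .
  have "dirac_x p (slice_fun (induced p D F1 F2) \<omega>) z = (\<Sum>i=0..p. oct_e i \<odot> (G1 i z + \<omega> \<odot> G2 i z))"
    unfolding dirac_x_def by (intro sum.cong refl) (simp add: has_partials_eq(1)[OF hp z])
  also have "\<dots> = H2 z - \<omega> \<odot> H1 z"
    using eq1[OF z] 2 by (simp add: oct.add_right sum.distrib)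
  finally show "dirac_x p (slice_fun (induced p D F1 F2) \<omega>) z
      + \<omega> \<odot> partial_r (slice_fun (induced p D F1 F2) \<omega>) z = 0"
    using p by (simp add: has_partials_eq(2)[OF hp z] oct.add_right unit_sphere_mult_self[OF \<omega>])
qed

lemma GSR_subset_GSM:
  assumes p: "p \<le> 6" and D: "reflection_invariant_open p D"
  shows "GSR p D \<subseteq> GSM p (p_completion p D)"
proof
  fix f assume "f \<in> GSR p D"
  then obtain F1 F2 where F: "f = induced p D F1 F2" "stem D F1 F2"
    "has_partials p D F1 (\<lambda>i. partial_x i F1) (partial_r F1)"
    "has_partials p D F2 (\<lambda>i. partial_x i F2) (partial_r F2)"
    "\<forall>z\<in>D. dirac_x p F1 z - partial_r F2 z = 0 \<and> dirac_x_conj p F2 z + partial_r F1 z = 0"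
    unfolding GSR_def C1_on_iff_has_partials by blast
  show "f \<in> GSM p (p_completion p D)"
    unfolding F(1)
    by (rule induced_in_GSM[OF p D F(2,3,4)]) (use F(5) in \<open>auto simp: dirac_x_def dirac_x_conj_def\<close>)
qed

text \<open>
  With \<open>g\<close> the restriction of \<open>f\<close> to the slice through \<open>\<eta>\<close> and \<open>R\<close> the reflection, the stem function
  consists of \<open>(g + g \<circ> R) / 2\<close> and \<open>- \<eta> \<odot> (g - g \<circ> R) / 2\<close>. The function \<open>g\<close> solves the slice
  equation for \<open>\<eta>\<close> and \<open>g \<circ> R\<close> solves the one for \<open>- \<eta>\<close>; sum and difference of the two are the
  stem equations.
\<close>

lemma GSM_slice_in_GSR:
  assumes p: "p \<le> 6" and D: "reflection_invariant_open p D" and f: "f \<in> GSM p (p_completion p D)"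
    and \<eta>: "\<eta> \<in> unit_sphere p"
  obtains k where "k \<in> GSR p D" "\<And>z. z \<in> D \<Longrightarrow> slice_fun k \<eta> z = slice_fun f \<eta> z"
proof -
  define g where "g = slice_fun f \<eta>"
  define G where "G i = partial_x i g" for i
  define H where "H = partial_r g"
  define R where "R z = (fst z, - snd z)" for z :: "oct \<times> real"
  define F1 where "F1 z = (1/2) *\<^sub>R (g z + g (R z))" for z
  define F2 where "F2 z = (- 1/2) *\<^sub>R (\<eta> \<odot> (g z + (- 1) *\<^sub>R g (R z)))" for z
  have mirror: "\<And>x r. (x, r) \<in> D \<Longrightarrow> (x, - r) \<in> D" using D by (auto simp: reflection_invariant_open_def)
  have RD: "R z \<in> D" if "z \<in> D" for z using mirror that by (cases z) (auto simp: R_def)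
  have sd: "slice_dom p (p_completion p D) \<eta> = D" by (rule slice_dom_p_completion[OF p D \<eta>])
  have g: "has_partials p D g G H"
    using f \<eta> sd unfolding GSM_def G_def H_def g_def C1_on_iff_has_partials[symmetric] by auto
  have eq: "(\<Sum>i=0..p. oct_e i \<odot> G i z) = - (\<eta> \<odot> H z)" if "z \<in> D" for z
    using f \<eta> sd that by (auto simp: GSM_def G_def H_def g_def dirac_x_def eq_neg_iff_add_eq_0)
  have h: "has_partials p D (\<lambda>z. g (R z)) (\<lambda>i z. G i (R z)) (\<lambda>z. - H (R z))"
    unfolding R_def by (rule has_partials_reflect[OF g mirror])
  have P1: "has_partials p D F1 (\<lambda>i z. (1/2) *\<^sub>R (G i z + G i (R z))) (\<lambda>z. (1/2) *\<^sub>R (H z + - H (R z)))"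
    unfolding F1_def by (rule has_partials_linear[OF has_partials_add[OF g h] bounded_linear_scaleR_right])
  have P2: "has_partials p D F2 (\<lambda>i z. (- 1/2) *\<^sub>R (\<eta> \<odot> (G i z + (- 1) *\<^sub>R G i (R z))))
      (\<lambda>z. (- 1/2) *\<^sub>R (\<eta> \<odot> (H z + (- 1) *\<^sub>R (- H (R z)))))"
    unfolding F2_def
    by (rule has_partials_linear[OF has_partials_linear[OF
          has_partials_add[OF g has_partials_linear[OF h bounded_linear_scaleR_right]]
          oct.bounded_linear_right] bounded_linear_scaleR_right])
  have st: "stem D F1 F2"
    unfolding stem_def F1_def F2_def R_def
    by (auto simp: oct.add_right oct.diff_right oct.minus_right algebra_simps)
  have "dirac_x p F1 z - partial_r F2 z = 0" if z: "z \<in> D" for z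
  proof -
    have "partial_x i F1 z = (1/2) *\<^sub>R (G i z + G i (R z))" if "i \<le> p" for i
      by (rule has_partials_eq(1)[OF P1 z that])
    then have "dirac_x p F1 z = (\<Sum>i=0..p. oct_e i \<odot> ((1/2) *\<^sub>R (G i z + G i (R z))))"
      unfolding dirac_x_def by simp
    also have "\<dots> = (1/2) *\<^sub>R ((\<Sum>i=0..p. oct_e i \<odot> G i z) + (\<Sum>i=0..p. oct_e i \<odot> G i (R z)))"
      by (simp only: oct.scaleR_right oct.add_right scaleR_sum_right[symmetric] sum.distrib)
    also have "\<dots> = partial_r F2 z"
      unfolding eq[OF z] eq[OF RD[OF z]] has_partials_eq(2)[OF P2 z]
      by (simp add: oct.add_right algebra_simps)
    finally show ?thesis by simp
  qed
  moreover have "dirac_x_conj p F2 z + partial_r F1 z = 0" if z: "z \<in> D" for z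
  proof -
    define S where "S i = G i z - G i (R z)" for i
    have S: "(\<Sum>i=0..p. oct_e i \<odot> S i) = - (\<eta> \<odot> (H z - H (R z)))"
      using eq[OF z] eq[OF RD[OF z]] by (simp add: S_def oct.diff_right sum_subtractf)
    have PS: "partial_x i F2 z = (- 1/2) *\<^sub>R (\<eta> \<odot> S i)" if "i \<le> p" for i
      using has_partials_eq(1)[OF P2 z that] by (simp add: S_def)
    have "oct_e i \<odot> partial_x i F2 z = (1/2) *\<^sub>R (\<eta> \<odot> (oct_e i \<odot> S i))" if i: "i \<in> {1..p}" for i
    proof -
      have "i \<le> p" using i by simp
      then show ?thesis
        unfolding PS[OF \<open>i \<le> p\<close>] oct.scaleR_right oct_e_unit_sphere_anticommute[OF \<eta> p i] by simp
    qed
    then have "(\<Sum>i=1..p. oct_e i \<odot> partial_x i F2 z) = (\<Sum>i=1..p. (1/2) *\<^sub>R (\<eta> \<odot> (oct_e i \<odot> S i)))"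
      by (rule sum.cong[OF refl])
    also have "\<dots> = (1/2) *\<^sub>R (\<eta> \<odot> (\<Sum>i=1..p. oct_e i \<odot> S i))"
      by (simp only: oct.sum_right scaleR_sum_right)
    finally have "dirac_x_conj p F2 z = (- 1/2) *\<^sub>R (\<eta> \<odot> (S 0 + (\<Sum>i=1..p. oct_e i \<odot> S i)))"
      unfolding dirac_x_conj_def by (simp add: PS oct.add_right algebra_simps)
    also have "S 0 + (\<Sum>i=1..p. oct_e i \<odot> S i) = (\<Sum>i=0..p. oct_e i \<odot> S i)"
      by (simp add: sum.atLeast_Suc_atMost)
    also have "(- 1/2) *\<^sub>R (\<eta> \<odot> (\<Sum>i=0..p. oct_e i \<odot> S i)) = - (1/2) *\<^sub>R (H z - H (R z))"
      unfolding S using p by (simp add: oct.minus_right unit_sphere_mult_self[OF \<eta>])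
    finally show ?thesis unfolding has_partials_eq(2)[OF P1 z] by simp
  qed
  ultimately have "induced p D F1 F2 \<in> GSR p D"
    unfolding GSR_def using st has_partials_C1_on[OF P1] has_partials_C1_on[OF P2] by blast
  moreover have "slice_fun (induced p D F1 F2) \<eta> z = slice_fun f \<eta> z" if "z \<in> D" for z
  proof -
    have "\<eta> \<odot> F2 z = (1/2) *\<^sub>R (g z - g (R z))"
      unfolding F2_def oct.scaleR_right using p
      by (simp add: unit_sphere_mult_self[OF \<eta>] flip: scaleR_minus_right)
    moreover have "(1/2) *\<^sub>R (a + b) + (1/2) *\<^sub>R (a - b) = a" for a b :: oct
      by (simp add: vec_eq_iff field_simps)
    ultimately show ?thesis
      unfolding induced_on_slice[OF p D st \<eta> that] F1_def g_def by simp
  qed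
  ultimately show thesis by (rule that)
qed

lemma real_point_in_param_domain:
  assumes p: "p \<le> 6" and D: "reflection_invariant_open p D"
    and x: "x \<in> p_completion p D" "x \<in> paravecs p"
  shows "(x, 0) \<in> D"
proof -
  obtain \<omega> where \<omega>: "\<omega> \<in> unit_sphere p" using oct_e_in_unit_sphere[of p 7] p by auto
  have "(x, 0) \<in> slice_dom p (p_completion p D) \<omega>"
    using x by (auto simp: slice_dom_def param_space_def)
  then show ?thesis using slice_dom_p_completion[OF p D \<omega>] by simp
qed

text \<open>
  A monogenic function and the regular function built from one of its slices agree on
  \<open>paravecs p\<close>. Their difference on another slice, cut off to zero for \<open>r \<le> 0\<close>, falls under the
  identity theorem with a starting point slightly below a point of \<open>D\<close> with \<open>r = 0\<close>.
\<close>

lemma GSM_subset_GSR: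
  assumes p: "p \<le> 6" and D: "reflection_invariant_open p D"
    and conn: "connected (p_completion p D)" and x0: "x0 \<in> p_completion p D" "x0 \<in> paravecs p"
  shows "GSM p (p_completion p D) \<subseteq> GSR p D"
proof
  fix f assume f: "f \<in> GSM p (p_completion p D)"
  have open_D: "openin (top_of_set (param_space p)) D" using D by (simp add: reflection_invariant_open_def)
  have x0D: "(x0, 0) \<in> D" by (rule real_point_in_param_domain[OF p D x0])
  have conn_D: "connected D" by (rule connected_param_domain[OF p conn D x0D])
  obtain \<eta> where \<eta>: "\<eta> \<in> unit_sphere p" using oct_e_in_unit_sphere[of p 7] p by auto
  obtain k where k: "k \<in> GSR p D" "\<And>z. z \<in> D \<Longrightarrow> slice_fun k \<eta> z = slice_fun f \<eta> z"
    by (rule GSM_slice_in_GSR[OF p D f \<eta>]) blast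
  have kM: "k \<in> GSM p (p_completion p D)" using GSR_subset_GSM[OF p D] k(1) by blast
  have real: "k x = f x" if "(x, 0) \<in> D" for x using k(2)[OF that] by (simp add: slice_fun_def)
  have upper: "slice_fun k \<omega> z = slice_fun f \<omega> z" if \<omega>: "\<omega> \<in> unit_sphere p" and z: "z \<in> D" "snd z > 0" for \<omega> z
  proof -
    define gf where "gf = slice_fun f \<omega>"
    define gk where "gk = slice_fun k \<omega>"
    define d where "d z = gf z + (- 1) *\<^sub>R gk z" for z
    define G where "G i z = partial_x i gf z + (- 1) *\<^sub>R partial_x i gk z" for i z
    define H where "H z = partial_r gf z + (- 1) *\<^sub>R partial_r gk z" for z
    have sd: "slice_dom p (p_completion p D) \<omega> = D" by (rule slice_dom_p_completion[OF p D \<omega>])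
    have P: "has_partials p D gf (\<lambda>i. partial_x i gf) (partial_r gf)"
      "has_partials p D gk (\<lambda>i. partial_x i gk) (partial_r gk)"
      using f kM \<omega> sd unfolding GSM_def gf_def gk_def C1_on_iff_has_partials[symmetric] by auto
    have Pd: "has_partials p D d G H"
      unfolding d_def G_def H_def
      by (rule has_partials_add[OF P(1) has_partials_linear[OF P(2) bounded_linear_scaleR_right]])
    have E: "(\<Sum>i=0..p. oct_e i \<odot> partial_x i gf w) + \<omega> \<odot> partial_r gf w = 0"
      "(\<Sum>i=0..p. oct_e i \<odot> partial_x i gk w) + \<omega> \<odot> partial_r gk w = 0" if "w \<in> D" for w
      using f kM \<omega> sd that unfolding GSM_def gf_def gk_def dirac_x_def by auto
    have Ed: "(\<Sum>i=0..p. oct_e i \<odot> G i w) + \<omega> \<odot> H w = 0" if "w \<in> D" for w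
    proof -
      have "(\<Sum>i=0..p. oct_e i \<odot> G i w) + \<omega> \<odot> H w
          = ((\<Sum>i=0..p. oct_e i \<odot> partial_x i gf w) + \<omega> \<odot> partial_r gf w)
            - ((\<Sum>i=0..p. oct_e i \<odot> partial_x i gk w) + \<omega> \<odot> partial_r gk w)"
        by (simp add: G_def H_def oct.diff_right sum_subtractf)
      then show ?thesis using E[OF that] by simp
    qed
    have d0: "d (x, 0) = 0" if "(x, 0) \<in> D" for x
      using real[OF that] by (simp add: d_def gf_def gk_def slice_fun_def)
    have G0: "G i (x, 0) = 0" if "(x, 0) \<in> D" "i \<le> p" for i x
      by (rule has_partials_tangential_zero[OF Pd open_D d0 that])
    have H0: "H (x, 0) = 0" if "(x, 0) \<in> D" for x
    proof -
      have "\<omega> \<odot> H (x, 0) = 0" using Ed[OF that] G0[OF that] by (simp add: oct.zero_right)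
      then show ?thesis using unit_sphere_mult_self[OF \<omega>, of "H (x, 0)"] p by (simp add: oct.zero_right)
    qed
    obtain T where T: "open T" "snd (x0, 0::real) \<in> T" "\<forall>t\<in>T. (fst (x0, 0::real), t) \<in> D"
      using open_lines(2)[OF open_D x0D] by blast
    then obtain e where e: "e > 0" "ball 0 e \<subseteq> T" using open_contains_ball by (metis snd_conv)
    then have "- (e / 2) \<in> T" by (intro subsetD[OF e(2)]) (simp add: dist_norm)
    then have z0: "(x0, - (e / 2)) \<in> D" using T(3) by simp
    have "upper_part d z = 0"
    proof (rule slice_identity_theorem[OF p open_D conn_D \<omega>
          has_partials_upper_part[OF Pd open_D d0 H0] _ z0, of "e / 2"])
      fix w assume "w \<in> D"
      then show "(\<Sum>i=0..p. oct_e i \<odot> upper_part (G i) w) + \<omega> \<odot> upper_part H w = 0"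
        using Ed by (simp add: upper_part_def oct.zero_right)
    next
      fix w assume "dist (x0, - (e / 2)) w < e / 2"
      then have "dist (- (e / 2)) (snd w) < e / 2"
        using dist_snd_le[of "(x0, - (e / 2))" w] by simp
      then have "snd w < 0" unfolding dist_real_def by arith
      then show "upper_part d w = 0" by (simp add: upper_part_def)
    qed (use e z in auto)
    then show ?thesis using z by (simp add: upper_part_def d_def gf_def gk_def)
  qed
  have "f = k"
  proof (rule extensionalityI[where A = "p_completion p D"])
    show "f \<in> extensional (p_completion p D)" "k \<in> extensional (p_completion p D)"
      using f kM by (auto simp: GSM_def)
    fix y assume "y \<in> p_completion p D"
    then obtain x r \<omega> where y: "y = x + r *\<^sub>R \<omega>" "\<omega> \<in> unit_sphere p" "r \<ge> 0" "(x, r) \<in> D"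
      unfolding p_completion_def by blast
    show "f y = k y"
    proof (cases "r = 0")
      case True
      then show ?thesis using real[of x] y by simp
    next
      case False
      then show ?thesis using upper[OF y(2,4)] y by (simp add: slice_fun_def)
    qed
  qed
  then show "f \<in> GSR p D" using k(1) by simp
qed

text \<open>
  The counterexample is \<open>oct_e 0\<close> on the half slice in direction \<open>oct_e 7\<close> and zero elsewhere. The
  opposite directions \<open>oct_e 6\<close> and \<open>- oct_e 6\<close>, available for \<open>p \<le> 5\<close>, show that an inducing stem
  function would vanish.
\<close>

lemma GSM_not_subset_GSR:
  assumes p: "p \<le> 5" and D: "reflection_invariant_open p D"
    and ne: "p_completion p D \<noteq> {}" and off: "p_completion p D \<inter> paravecs p = {}"
  shows "\<not> GSM p (p_completion p D) \<subseteq> GSR p D"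
proof -
  have p6: "p \<le> 6" using p by simp
  define \<Omega> where "\<Omega> = p_completion p D"
  have open_D: "openin (top_of_set (param_space p)) D" using D by (simp add: reflection_invariant_open_def)
  have sub: "D \<subseteq> param_space p" using open_D by (rule openin_imp_subset)
  have e7: "oct_e 7 \<in> unit_sphere p" and e6: "oct_e 6 \<in> unit_sphere p"
    using oct_e_in_unit_sphere p by auto
  have neq: "oct_e 6 \<noteq> oct_e 7" "- oct_e 6 \<noteq> oct_e 7"
  proof -
    have i: "oct_e 6 \<bullet> oct_e 7 = 0" "oct_e 7 \<bullet> oct_e 7 = 1"
      using inner_oct_e[of 6 7] inner_oct_e[of 7 7] by simp_all
    then show "oct_e 6 \<noteq> oct_e 7" by (metis zero_neq_one)
    show "- oct_e 6 \<noteq> oct_e 7"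
      using i inner_minus_left[of "oct_e 6" "oct_e 7"] by (metis minus_zero zero_neq_one)
  qed
  have r0: "r \<noteq> 0" if "(x, r) \<in> D" for x r
  proof
    assume "r = 0"
    then have "x + 0 *\<^sub>R oct_e 7 \<in> \<Omega>" using that e7 unfolding \<Omega>_def p_completion_def by blast
    then have "x \<in> \<Omega>" by simp
    then show False using off that sub by (auto simp: \<Omega>_def param_space_def)
  qed
  define f where "f = (\<lambda>y\<in>\<Omega>. if \<exists>x\<in>paravecs p. \<exists>r>0. y = x + r *\<^sub>R oct_e 7 then oct_e 0 else 0)"
  have pos: "f (x + r *\<^sub>R \<omega>) = (if \<omega> = oct_e 7 then oct_e 0 else 0)"
    if "x \<in> paravecs p" "r > 0" "\<omega> \<in> unit_sphere p" "x + r *\<^sub>R \<omega> \<in> \<Omega>" for x r \<omega>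
  proof -
    have "(\<exists>y\<in>paravecs p. \<exists>s>0. x + r *\<^sub>R \<omega> = y + s *\<^sub>R oct_e 7) \<longleftrightarrow> \<omega> = oct_e 7"
    proof
      assume "\<exists>y\<in>paravecs p. \<exists>s>0. x + r *\<^sub>R \<omega> = y + s *\<^sub>R oct_e 7"
      then obtain y s where "y \<in> paravecs p" "s > 0" "x + r *\<^sub>R \<omega> = y + s *\<^sub>R oct_e 7" by blast
      then show "\<omega> = oct_e 7"
        using p_completion_decomp_unique(3)[of x p y \<omega> "oct_e 7" r s] that e7 p by auto
    qed (use that in auto)
    then show ?thesis using that by (simp add: f_def)
  qed
  have slice: "slice_fun f \<omega> z = (if snd z > 0 then if \<omega> = oct_e 7 then oct_e 0 else 0
      else if - \<omega> = oct_e 7 then oct_e 0 else 0)" if \<omega>: "\<omega> \<in> unit_sphere p" and z: "z \<in> D" for \<omega> z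
  proof -
    have zd: "z \<in> slice_dom p \<Omega> \<omega>" using slice_dom_p_completion[OF p6 D \<omega>] z by (simp add: \<Omega>_def)
    obtain x r where [simp]: "z = (x, r)" by (cases z)
    have x: "x \<in> paravecs p" "x + r *\<^sub>R \<omega> \<in> \<Omega>" using zd by (auto simp: slice_dom_def param_space_def)
    show ?thesis
    proof (cases "r > 0")
      case True
      then show ?thesis using pos[OF x(1) _ \<omega> x(2)] by (simp add: slice_fun_def)
    next
      case False
      then have "- r > 0" using r0[of x r] z by simp
      moreover have "x + (- r) *\<^sub>R (- \<omega>) \<in> \<Omega>" using x(2) by simp
      ultimately have "f (x + (- r) *\<^sub>R (- \<omega>)) = (if - \<omega> = oct_e 7 then oct_e 0 else 0)"
        using pos[OF x(1) _ uminus_in_unit_sphere[OF \<omega>]] by blast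
      then show ?thesis using False by (simp add: slice_fun_def)
    qed
  qed
  have step: "has_partials p D (\<lambda>z. if snd z > 0 then a else b) (\<lambda>_ _. 0) (\<lambda>_. 0)" for a b
  proof -
    have "((\<lambda>t. if t > 0 then a else b) has_vector_derivative 0) (at r)" if "r \<noteq> 0" for r :: real
    proof (cases "r > 0")
      case True
      then show ?thesis
        by - (rule has_vector_derivative_transform_within_open[OF has_vector_derivative_const, of "{0<..}" r a], auto)
    next
      case False
      then show ?thesis using that
        by - (rule has_vector_derivative_transform_within_open[OF has_vector_derivative_const, of "{..<0}" r b], auto)
    qed
    moreover have "snd z \<noteq> 0" if "z \<in> D" for z using r0 that by (cases z) auto
    ultimately show ?thesis by (auto simp: has_partials_def)
  qed
  have "f \<in> GSM p \<Omega>"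
    unfolding GSM_def
  proof (intro CollectI conjI ballI)
    show "f \<in> extensional \<Omega>" by (simp add: f_def)
    fix \<omega> assume \<omega>: "\<omega> \<in> unit_sphere p"
    have sd: "slice_dom p \<Omega> \<omega> = D" unfolding \<Omega>_def by (rule slice_dom_p_completion[OF p6 D \<omega>])
    have hp: "has_partials p D (slice_fun f \<omega>) (\<lambda>_ _. 0) (\<lambda>_. 0)"
      by (rule has_partials_cong[OF step open_D slice[OF \<omega>]])
    show "C1_on p (slice_dom p \<Omega> \<omega>) (slice_fun f \<omega>)"
      unfolding sd by (rule has_partials_C1_on[OF hp])
    show "dirac_x p (slice_fun f \<omega>) z + \<omega> \<odot> partial_r (slice_fun f \<omega>) z = 0" if "z \<in> slice_dom p \<Omega> \<omega>" for z
      using that has_partials_eq[OF hp, of z] by (simp add: sd dirac_x_def oct.zero_right)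
  qed
  moreover have "f \<notin> GSR p D"
  proof
    assume "f \<in> GSR p D"
    then obtain F1 F2 where F: "f = induced p D F1 F2" "stem D F1 F2" unfolding GSR_def by blast
    obtain x r \<omega> where xr: "\<omega> \<in> unit_sphere p" "r \<ge> 0" "(x, r) \<in> D"
      using ne unfolding p_completion_def by blast
    then have r: "r > 0" using r0 by (metis less_eq_real_def)
    have val: "F1 (x, r) + \<omega> \<odot> F2 (x, r) = (if \<omega> = oct_e 7 then oct_e 0 else 0)"
      if "\<omega> \<in> unit_sphere p" for \<omega>
      using induced_on_slice[OF p6 D F(2) that xr(3)] slice[OF that xr(3)] r by (simp add: F(1))
    have m6: "- oct_e 6 \<in> unit_sphere p" by (rule uminus_in_unit_sphere[OF e6])
    have 1: "F1 (x, r) + oct_e 6 \<odot> F2 (x, r) = 0" "F1 (x, r) - oct_e 6 \<odot> F2 (x, r) = 0"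
      using val[OF e6] val[OF m6] neq by (simp_all add: oct.minus_left)
    then have "2 *\<^sub>R F1 (x, r) = 0" by (simp add: scaleR_2)
    then have "F1 (x, r) = 0" by simp
    with 1 have "oct_e 6 \<odot> F2 (x, r) = 0" by simp
    then have "F2 (x, r) = 0"
      using unit_sphere_mult_self[OF e6, of "F2 (x, r)"] p by (simp add: oct.zero_right)
    with \<open>F1 (x, r) = 0\<close> val[OF e7] have "oct_e 0 = 0" by (simp add: oct.zero_right)
    then show False using inner_oct_e[of 0 0] by simp
  qed
  ultimately show ?thesis unfolding \<Omega>_def by blast
qed

text \<open>
  By symmetry the coordinate along \<open>oct_e 7\<close> takes a nonnegative and a nonpositive value on the
  completion, hence by connectedness the value 0. Its zeros in the completion lie in \<open>paravecs 6\<close>.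
\<close>

lemma connected_completion_type_6_meets_paravecs:
  assumes D: "reflection_invariant_open 6 D" and conn: "connected (p_completion 6 D)"
    and ne: "p_completion 6 D \<noteq> {}"
  shows "p_completion 6 D \<inter> paravecs 6 \<noteq> {}"
proof -
  have sub: "D \<subseteq> param_space 6"
    using D by (auto simp: reflection_invariant_open_def dest: openin_imp_subset)
  have e7: "oct_e 7 \<in> unit_sphere 6" using oct_e_in_unit_sphere by simp
  have inner: "(x + r *\<^sub>R \<omega>) \<bullet> oct_e 7 = r * (\<omega> \<bullet> oct_e 7)" if "(x, r) \<in> D" for x r \<omega>
  proof -
    have "x \<bullet> oct_e 7 = 0"
      using that sub by (intro inner_paravecs_unit_sphere[OF _ e7]) (auto simp: param_space_def)
    then show ?thesis by (simp add: inner_add_left)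
  qed
  have sphere: "\<omega> \<bullet> oct_e 7 \<noteq> 0" if "\<omega> \<in> unit_sphere 6" for \<omega>
    using that inner_oct_e[of 7 7] by (auto simp: unit_sphere_def)
  obtain x r where xr: "(x, r) \<in> D" "r \<ge> 0" using ne unfolding p_completion_def by blast
  have 1: "x + r *\<^sub>R oct_e 7 \<in> p_completion 6 D" "x + r *\<^sub>R (- oct_e 7) \<in> p_completion 6 D"
    using xr e7 uminus_in_unit_sphere[OF e7] unfolding p_completion_def by blast+
  have "(x + r *\<^sub>R (- oct_e 7)) \<bullet> oct_e 7 \<le> 0" "0 \<le> (x + r *\<^sub>R oct_e 7) \<bullet> oct_e 7"
    unfolding inner[OF xr(1)] using xr(2) inner_oct_e[of 7 7] by simp_all
  then obtain y where y: "y \<in> p_completion 6 D" "y \<bullet> oct_e 7 = 0"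
    using connected_ivt_component[OF conn 1(2,1)] by blast
  then obtain x' r' \<omega> where h: "y = x' + r' *\<^sub>R \<omega>" "\<omega> \<in> unit_sphere 6" "(x', r') \<in> D"
    unfolding p_completion_def by blast
  then have "r' = 0" using inner[OF h(3)] sphere[OF h(2)] y(2) by simp
  then have "y \<in> paravecs 6" using h sub by (auto simp: param_space_def)
  then show ?thesis using y(1) by blast
qed

theorem theorem5p8:
  fixes p :: nat and \<Omega> :: "oct set" and D :: "(oct \<times> real) set"
  assumes "p \<le> 6"
    and "is_domain \<Omega>"
    and "p_symmetric p \<Omega>"
    and "reflection_invariant_open p D"
    and "\<Omega> = p_completion p D"
  shows "(\<Omega> \<inter> paravecs p = {} \<longrightarrow> GSR p D \<subset> GSM p \<Omega>)
       \<and> (\<Omega> \<inter> paravecs p \<noteq> {} \<longrightarrow> GSM p \<Omega> = GSR p D)"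
proof (intro conjI impI)
  have conn: "connected (p_completion p D)" and ne: "p_completion p D \<noteq> {}"
    using assms by (auto simp: is_domain_def)
  have sub: "GSR p D \<subseteq> GSM p \<Omega>"
    unfolding assms(5) by (rule GSR_subset_GSM[OF assms(1,4)])
  {
    assume off: "\<Omega> \<inter> paravecs p = {}"
    have "p \<noteq> 6"
      using connected_completion_type_6_meets_paravecs[of D] assms(4,5) conn ne off by auto
    then have "\<not> GSM p \<Omega> \<subseteq> GSR p D"
      using GSM_not_subset_GSR[of p D] assms(1,4,5) ne off by simp
    with sub show "GSR p D \<subset> GSM p \<Omega>" by blast
  next
    assume "\<Omega> \<inter> paravecs p \<noteq> {}"
    then obtain x0 where "x0 \<in> p_completion p D" "x0 \<in> paravecs p" using assms(5) by blast
    from GSM_subset_GSR[OF assms(1,4) conn this] sub show "GSM p \<Omega> = GSR p D"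
      unfolding assms(5) by blast
  }
qed

end
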